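(* If $\mathbb{E}[S_1]<+\infty$ and $\mathbb{E}[M_1]<+\infty$, then $$\lim_{t\uparrow+\infty}\frac{F_t}{t}=\frac{\mathbb{E}[X_1]}{\mathbb{E}[S_1]}=:\mu\qquad\mathbb{P}\text{-a.s.}$$
   Context: Let $(\Omega,\mathcal{F},\mathbb{P})$ be a probability space with expectation $\mathbb{E}$. Let $S_1,S_2,\ldots$ (waiting times) be i.i.d. non-negative real random variables with $\mathbb{P}[S_1=0]<1$; put $T_0:=0$, $T_n:=S_1+\cdots+S_n$, and $N_t:=\sup\{n\ge 0:T_n\le t\}$ for $t\ge 0$ (almost surely finite for all $t$). Let $\{B_{1,t}\}_{t\ge 0},\{B_{2,t}\}_{t\ge 0},\ldots$ be i.i.d. $\mathbb{R}$-valued stochastic processes with measurable sample paths, independent of the waiting times. The process under resetting is $Z_t:=B_{N_t+1,\,t-T_{N_t}}$, $t\ge 0$. Let $f:\mathbb{R}\to\mathbb{R}$ be measurable and define the additive functional $$F_t:=\int_0^t f(Z_\tau)\,d\tau,$$ together with $$X_n:=\int_0^{S_n}f(B_{n,\tau})\,d\tau,\qquad M_n:=\int_0^{S_n}|f(B_{n,\tau})|\,d\tau .$$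
   Formalization: The processes are assumed jointly measurable in time and sample point, not merely to have measurable sample paths; with path-wise measurability alone X_n and M_n need not be random variables and the claim can fail. *)

theory Defs
  imports "HOL-Probability.Probability"
begin

definition reset_time :: "(nat \<Rightarrow> 'a \<Rightarrow> real) \<Rightarrow> nat \<Rightarrow> 'a \<Rightarrow> real" where
  "reset_time S n \<omega> = (\<Sum>i=1..n. S i \<omega>)"

text \<open>
  On the null event that infinitely many resets occur up to time \<open>t\<close>, the supremum below is
  taken in \<^typ>\<open>nat\<close> and has an unspecified value.
\<close>

definition reset_count :: "(nat \<Rightarrow> 'a \<Rightarrow> real) \<Rightarrow> real \<Rightarrow> 'a \<Rightarrow> nat" where
  "reset_count S t \<omega> = Sup {n. reset_time S n \<omega> \<le> t}"

definition reset_process ::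
    "(nat \<Rightarrow> 'a \<Rightarrow> real) \<Rightarrow> (nat \<Rightarrow> real \<Rightarrow> 'a \<Rightarrow> real) \<Rightarrow> real \<Rightarrow> 'a \<Rightarrow> real" where
  "reset_process S B t \<omega> =
     B (reset_count S t \<omega> + 1) (t - reset_time S (reset_count S t \<omega>) \<omega>) \<omega>"

definition additive_functional ::
    "(nat \<Rightarrow> 'a \<Rightarrow> real) \<Rightarrow> (nat \<Rightarrow> real \<Rightarrow> 'a \<Rightarrow> real) \<Rightarrow> (real \<Rightarrow> real) \<Rightarrow> real \<Rightarrow> 'a \<Rightarrow> real"
  where
  "additive_functional S B f t \<omega> = (LBINT \<tau>:{0..t}. f (reset_process S B \<tau> \<omega>))"

definition cycle_integral ::
    "(nat \<Rightarrow> 'a \<Rightarrow> real) \<Rightarrow> (nat \<Rightarrow> real \<Rightarrow> 'a \<Rightarrow> real) \<Rightarrow> (real \<Rightarrow> real) \<Rightarrow> nat \<Rightarrow> 'a \<Rightarrow> real"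
  where
  "cycle_integral S B f n \<omega> = (LBINT \<tau>:{0..S n \<omega>}. f (B n \<tau> \<omega>))"

text \<open>Extended-valued, as the integral may diverge for some \<open>\<omega>\<close>.\<close>

definition cycle_abs_integral ::
    "(nat \<Rightarrow> 'a \<Rightarrow> real) \<Rightarrow> (nat \<Rightarrow> real \<Rightarrow> 'a \<Rightarrow> real) \<Rightarrow> (real \<Rightarrow> real) \<Rightarrow> nat \<Rightarrow> 'a \<Rightarrow> ennreal"
  where
  "cycle_abs_integral S B f n \<omega> = (\<integral>\<^sup>+\<tau>\<in>{0..S n \<omega>}. ennreal \<bar>f (B n \<tau> \<omega>)\<bar> \<partial>lborel)"

text \<open>
  The process \<open>B n\<close> as a random element of \<open>[0,\<infinity>) \<rightarrow> \<real>\<close> with the product (cylinder)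
  \<open>\<sigma>\<close>-algebra. Independence in this space is independence of the \<open>\<sigma>\<close>-algebras generated by
  the processes, and equality of laws is equality of all finite-dimensional distributions.
\<close>

abbreviation path_space :: "(real \<Rightarrow> real) measure" where
  "path_space \<equiv> (\<Pi>\<^sub>M t\<in>{0..}. borel)"

definition sample_path :: "(nat \<Rightarrow> real \<Rightarrow> 'a \<Rightarrow> real) \<Rightarrow> nat \<Rightarrow> 'a \<Rightarrow> real \<Rightarrow> real" where
  "sample_path B n \<omega> = (\<lambda>t\<in>{0..}. B n t \<omega>)"

text \<open>
  The sequences \<open>S\<close> and \<open>B\<close> are indexed from 1, and the processes have time set \<open>[0,\<infinity>)\<close>;
  nothing is assumed about other indices or times.

  The assumption \<open>B_measurable\<close> is joint measurability in time and sample point. It entails that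
  all sample paths are measurable. Measurability of the individual paths alone would make neither
  the time integrals of \<open>f (B n \<tau>)\<close> random variables nor their laws functions of the
  law of the process \<open>B n\<close>.

  The assumption \<open>S_B_indep\<close> is stated for the generated \<open>\<sigma>\<close>-algebras since
  \<^const>\<open>prob_space.indep_var\<close> requires both random variables to have values of the same type.
\<close>

locale resetting = prob_space M for M :: "'a measure" +
  fixes S :: "nat \<Rightarrow> 'a \<Rightarrow> real"
    and B :: "nat \<Rightarrow> real \<Rightarrow> 'a \<Rightarrow> real"
  assumes S_nonneg: "\<And>n \<omega>. n \<ge> 1 \<Longrightarrow> \<omega> \<in> space M \<Longrightarrow> S n \<omega> \<ge> 0"
    and S_indep: "indep_vars (\<lambda>_. borel) S {1..}"
    and S_ident: "\<And>n. n \<ge> 1 \<Longrightarrow> distr M borel (S n) = distr M borel (S 1)"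
    and S_nontrivial: "prob {\<omega> \<in> space M. S 1 \<omega> = 0} < 1"
    and B_measurable:
      "\<And>n. n \<ge> 1 \<Longrightarrow>
        (\<lambda>(t, \<omega>). B n t \<omega>) \<in> borel_measurable (restrict_space borel {0..} \<Otimes>\<^sub>M M)"
    and B_indep: "indep_vars (\<lambda>_. path_space) (sample_path B) {1..}"
    and B_ident:
      "\<And>n. n \<ge> 1 \<Longrightarrow>
        distr M path_space (sample_path B n) = distr M path_space (sample_path B 1)"
    and S_B_indep:
      "indep_set
        (sets (vimage_algebra (space M) (\<lambda>\<omega>. \<lambda>n\<in>{1..}. S n \<omega>) (\<Pi>\<^sub>M n\<in>{1..}. borel)))
        (sets (vimage_algebra (space M) (\<lambda>\<omega>. \<lambda>n\<in>{1..}. sample_path B n \<omega>)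
          (\<Pi>\<^sub>M n\<in>{1..}. path_space)))"
begin

lemma sample_path_measurable:
  assumes "n \<ge> 1" "\<omega> \<in> space M"
  shows "(\<lambda>t. B n t \<omega>) \<in> borel_measurable (restrict_space borel {0..})"
  using measurable_compose[OF measurable_Pair2'[OF assms(2)] B_measurable[OF assms(1)]]
  by simp

end

end

theory Submission
  imports Defs
begin

text \<open>
  Up to time \<open>t\<close> the path consists of \<open>N\<^sub>t\<close> complete cycles and one unfinished cycle. The complete
  cycles contribute \<open>X\<^sub>1 + \<dots> + X\<^bsub>N\<^sub>t\<^esub>\<close> to \<open>F\<^sub>t\<close>, and the unfinished one at most \<open>M\<^bsub>N\<^sub>t + 1\<^esub>\<close> in absolute
  value. If the averages of the waiting times, of the \<open>X\<^sub>i\<close> and of the \<open>M\<^sub>i\<close> converge along a sample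
  point, then \<open>t / N\<^sub>t \<rightarrow> E[S\<^sub>1]\<close>, because \<open>t\<close> lies between two consecutive reset times, and
  \<open>F\<^sub>t / N\<^sub>t \<rightarrow> E[X\<^sub>1]\<close>, because the terms \<open>M\<^bsub>n+1\<^esub> / n\<close> of a convergent average tend to zero. Dividing gives
  the limit. This purely deterministic argument is carried out in the locale \<open>reset_path\<close>.

  What remains is the strong law of large numbers for the three sequences. It is proved in Etemadi's
  form, \<open>strong_law_pairwise_independent\<close>, which asks only for pairwise independence: truncate, bound
  variances along a geometrically growing subsequence of indices, and interpolate by monotonicity.

  To apply it one must know that the \<open>X\<^sub>n\<close> are pairwise independent with a common law. This is not
  immediate: the hypotheses speak of the cylinder \<open>\<sigma>\<close>-algebra on the path space, and the time integral
  of a path is not a measurable function for that \<open>\<sigma>\<close>-algebra. However, by Monte Carlo integration,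
  for each fixed integrable function the weighted averages over i.i.d. random nodes converge to its
  integral. By Fubini's theorem one can fix a single deterministic sequence of nodes that works almost
  surely for every cycle (\<open>common_quadrature_nodes\<close>). Hence \<open>X\<^sub>n\<close> agrees almost surely with a limit of
  functions of the waiting time and of countably many coordinates of the path. This limit is one and
  the same measurable functional \<open>\<Phi>\<close> of the pair \<open>(S\<^sub>n, B\<^sub>n)\<close> for all \<open>n\<close>
  (\<open>cycle_integral_functional\<close>), and independence and equality of laws pass from the pairs to the
  \<open>X\<^sub>n\<close>. The same statement for \<open>\<bar>f\<bar>\<close> and for the constant function 1 covers the \<open>M\<^sub>n\<close> and the \<open>S\<^sub>n\<close>.
\<close>

section \<open>Averages of real sequences\<close>

lemma cesaro_mean:
  fixes x :: "nat \<Rightarrow> real"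
  assumes "x \<longlonglongrightarrow> L"
  shows "(\<lambda>n. (\<Sum>i<n. x i) / real n) \<longlonglongrightarrow> L"
proof (rule LIMSEQ_I)
  fix e :: real assume e: "e > 0"
  then obtain N where N: "\<And>i. i \<ge> N \<Longrightarrow> \<bar>x i - L\<bar> < e / 2"
    using LIMSEQ_D[OF assms, of "e/2"] by auto
  define C where "C = (\<Sum>i<N. \<bar>x i - L\<bar>)"
  have "(\<lambda>n. C / real n) \<longlonglongrightarrow> 0" by (rule lim_const_over_n)
  then obtain N' where N': "\<And>n. n \<ge> N' \<Longrightarrow> \<bar>C / real n\<bar> < e / 2"
    using LIMSEQ_D[of "\<lambda>n. C / real n" 0 "e/2"] e by auto
  have "\<bar>(\<Sum>i<n. x i) / real n - L\<bar> < e" if n: "n \<ge> max 1 (max N N')" for n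
  proof -
    have n0: "real n > 0" using n by auto
    have "\<bar>\<Sum>i<n. x i - L\<bar> \<le> (\<Sum>i<n. \<bar>x i - L\<bar>)" by (rule sum_abs)
    also have "\<dots> = (\<Sum>i\<in>{..<N} \<union> {N..<n}. \<bar>x i - L\<bar>)"
      by (rule sum.cong) (use n in auto)
    also have "\<dots> = C + (\<Sum>i\<in>{N..<n}. \<bar>x i - L\<bar>)"
      unfolding C_def by (rule sum.union_disjoint) auto
    also have "(\<Sum>i\<in>{N..<n}. \<bar>x i - L\<bar>) \<le> (\<Sum>i\<in>{N..<n}. e / 2)"
      by (rule sum_mono) (use N less_imp_le in auto)
    also have "\<dots> \<le> real n * (e / 2)" using e by (simp add: mult_right_mono)
    finally have "\<bar>\<Sum>i<n. x i - L\<bar> / real n \<le> (C + real n * (e / 2)) / real n"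
      using n0 by (simp add: divide_right_mono)
    also have "\<dots> = C / real n + e / 2" using n0 by (simp add: field_simps)
    also have "\<dots> < e"
    proof -
      have "\<bar>C / real n\<bar> < e / 2" using n by (intro N') simp
      then show ?thesis by linarith
    qed
    finally have "\<bar>\<Sum>i<n. x i - L\<bar> / real n < e" .
    moreover have "(\<Sum>i<n. x i) / real n - L = (\<Sum>i<n. x i - L) / real n"
      using n0 by (simp add: sum_subtractf field_simps)
    ultimately show ?thesis by simp
  qed
  then show "\<exists>no. \<forall>n\<ge>no. norm ((\<Sum>i<n. x i) / real n - L) < e"
    unfolding real_norm_def by blast
qed

definition geometric_index :: "real \<Rightarrow> nat \<Rightarrow> nat" where
  "geometric_index c n = nat \<lceil>c ^ n\<rceil>"

lemma geometric_index_bounds: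
  assumes "c > 1"
  shows "c ^ n \<le> real (geometric_index c n)" "real (geometric_index c n) \<le> c ^ n + 1"
    "geometric_index c n \<ge> 1"
proof -
  have "c ^ n \<ge> 1" using assms by simp
  then show "c ^ n \<le> real (geometric_index c n)" "real (geometric_index c n) \<le> c ^ n + 1"
    unfolding geometric_index_def by linarith+
  then show "geometric_index c n \<ge> 1" using \<open>c ^ n \<ge> 1\<close> by linarith
qed

lemma mono_geometric_index:
  assumes "c > 1"
  shows "mono (geometric_index c)"
  unfolding geometric_index_def using assms
  by (intro monoI nat_mono ceiling_mono power_increasing) auto

lemma filterlim_geometric_index:
  assumes "c > 1"
  shows "filterlim (geometric_index c) at_top sequentially"
  unfolding filterlim_at_top eventually_sequentially
proof
  fix Z
  obtain n0 where "real Z < c ^ n0" using real_arch_pow[OF assms] by blast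
  then have "Z \<le> geometric_index c n0"
    using geometric_index_bounds(1)[OF assms, of n0] by linarith
  then show "\<exists>N. \<forall>n\<ge>N. Z \<le> geometric_index c n"
    using monoD[OF mono_geometric_index[OF assms]] order_trans by blast
qed

lemma geometric_index_ratio:
  assumes "c > 1"
  shows "(\<lambda>n. real (geometric_index c (Suc n)) / real (geometric_index c n)) \<longlonglongrightarrow> c"
proof -
  have *: "(\<lambda>n. real (geometric_index c n) / c ^ n) \<longlonglongrightarrow> 1"
  proof (rule tendsto_sandwich)
    show "\<forall>\<^sub>F n in sequentially. 1 \<le> real (geometric_index c n) / c ^ n"
      using geometric_index_bounds[OF assms] assms by (simp add: field_simps)
    show "\<forall>\<^sub>F n in sequentially. real (geometric_index c n) / c ^ n \<le> 1 + 1 / c ^ n"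
      using geometric_index_bounds[OF assms] assms by (simp add: field_simps)
    show "(\<lambda>n. 1 + 1 / c ^ n) \<longlonglongrightarrow> 1"
      using tendsto_add[OF tendsto_const LIMSEQ_inverse_realpow_zero[OF assms], of 1]
      by (simp add: divide_inverse)
  qed auto
  have "(\<lambda>n. c * ((real (geometric_index c (Suc n)) / c ^ Suc n) / (real (geometric_index c n) / c ^ n)))
     \<longlonglongrightarrow> c * (1 / 1)"
    by (intro tendsto_intros * LIMSEQ_Suc[OF *]) auto
  moreover have "c * ((real (geometric_index c (Suc n)) / c ^ Suc n) / (real (geometric_index c n) / c ^ n))
     = real (geometric_index c (Suc n)) / real (geometric_index c n)" for n
    using assms geometric_index_bounds(3)[OF assms, of n] by (simp add: field_simps)
  ultimately show ?thesis by (simp only: mult_1_right div_by_1)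
qed

text \<open>
  Between two consecutive indices \<open>k m \<le> n < k (m + 1)\<close> a monotone sequence satisfies
  \<open>T (k m) / k (m + 1) \<le> T n / n \<le> T (k (m + 1)) / k m\<close>. Since \<open>k (m + 1) / k m\<close> tends to \<open>c\<close>, the limit
  points of \<open>T n / n\<close> lie between \<open>\<mu> / c\<close> and \<open>\<mu> c\<close>, and \<open>c\<close> is then sent to 1. Only countably many
  values of \<open>c\<close> occur, so that in applications the exceptional null sets can be united.
\<close>

lemma mono_mean_tendsto_from_geometric:
  fixes T :: "nat \<Rightarrow> real"
  assumes mono: "mono T" and nonneg: "\<And>n. T n \<ge> 0"
  assumes lim: "\<And>j. (\<lambda>n. T (geometric_index (1 + 1 / real (Suc j)) n) /
      real (geometric_index (1 + 1 / real (Suc j)) n)) \<longlonglongrightarrow> \<mu>"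
  shows "(\<lambda>n. T n / real n) \<longlonglongrightarrow> \<mu>"
proof (rule LIMSEQ_I)
  fix e :: real assume e: "e > 0"
  have one: "(\<lambda>j. 1 + 1 / real (Suc j)) \<longlonglongrightarrow> 1"
    using tendsto_add[OF tendsto_const LIMSEQ_inverse_real_of_nat, of 1] by (simp add: divide_inverse)
  have "(\<lambda>j. (1 + 1 / real (Suc j)) * \<mu>) \<longlonglongrightarrow> \<mu>"
    using tendsto_mult[OF one tendsto_const, of \<mu>] by simp
  then have "\<forall>\<^sub>F j in sequentially. (1 + 1 / real (Suc j)) * \<mu> < \<mu> + e / 2"
    by (rule order_tendstoD) (use e in auto)
  moreover have "(\<lambda>j. \<mu> / (1 + 1 / real (Suc j))) \<longlonglongrightarrow> \<mu>"
    using tendsto_divide[OF tendsto_const one, of \<mu>] by simp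
  then have "\<forall>\<^sub>F j in sequentially. \<mu> / (1 + 1 / real (Suc j)) > \<mu> - e / 2"
    by (rule order_tendstoD) (use e in auto)
  ultimately have "\<forall>\<^sub>F j in sequentially. (1 + 1 / real (Suc j)) * \<mu> < \<mu> + e / 2 \<and>
      \<mu> / (1 + 1 / real (Suc j)) > \<mu> - e / 2"
    by (rule eventually_conj)
  then obtain j where j: "(1 + 1 / real (Suc j)) * \<mu> < \<mu> + e / 2"
      "\<mu> / (1 + 1 / real (Suc j)) > \<mu> - e / 2"
    by (auto simp: eventually_sequentially)
  define c where "c = 1 + 1 / real (Suc j)"
  have c: "c > 1" by (simp add: c_def)
  define k where "k = geometric_index c"
  have k_pos: "real (k m) > 0" for m
    using geometric_index_bounds(3)[OF c, of m] by (simp add: k_def)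
  have lim_k: "(\<lambda>n. T (k n) / real (k n)) \<longlonglongrightarrow> \<mu>"
    using lim[of j] by (simp add: k_def c_def)
  have ratio: "(\<lambda>n. real (k (Suc n)) / real (k n)) \<longlonglongrightarrow> c"
    unfolding k_def by (rule geometric_index_ratio[OF c])
  have u: "(\<lambda>m. (T (k (Suc m)) / real (k (Suc m))) * (real (k (Suc m)) / real (k m))) \<longlonglongrightarrow> \<mu> * c"
    by (intro tendsto_mult LIMSEQ_Suc[OF lim_k] ratio)
  have "(T (k (Suc m)) / real (k (Suc m))) * (real (k (Suc m)) / real (k m)) = T (k (Suc m)) / real (k m)" for m
    using k_pos[of m] k_pos[of "Suc m"] by (simp only: times_divide_times_eq) simp
  with u have upper: "(\<lambda>m. T (k (Suc m)) / real (k m)) \<longlonglongrightarrow> \<mu> * c" by (simp only:)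
  have l: "(\<lambda>m. (T (k m) / real (k m)) / (real (k (Suc m)) / real (k m))) \<longlonglongrightarrow> \<mu> / c"
    by (intro tendsto_divide lim_k ratio) (use c in auto)
  have "(T (k m) / real (k m)) / (real (k (Suc m)) / real (k m)) = T (k m) / real (k (Suc m))" for m
    using k_pos[of m] k_pos[of "Suc m"] by (simp only: divide_divide_times_eq) simp
  with l have lower: "(\<lambda>m. T (k m) / real (k (Suc m))) \<longlonglongrightarrow> \<mu> / c" by (simp only:)
  have "\<forall>\<^sub>F m in sequentially.
      T (k (Suc m)) / real (k m) < \<mu> * c + e / 2 \<and> T (k m) / real (k (Suc m)) > \<mu> / c - e / 2"
    using e by (intro eventually_conj order_tendstoD(2)[OF upper] order_tendstoD(1)[OF lower]) simp_all
  then obtain m0 where m0: "\<And>m. m \<ge> m0 \<Longrightarrow> T (k (Suc m)) / real (k m) < \<mu> * c + e / 2"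
     "\<And>m. m \<ge> m0 \<Longrightarrow> T (k m) / real (k (Suc m)) > \<mu> / c - e / 2"
    unfolding eventually_sequentially by blast
  have "\<bar>T n / real n - \<mu>\<bar> < e" if n: "n \<ge> k m0" for n
  proof -
    define m where "m = (LEAST m. n < k (Suc m))"
    have "\<exists>m. n < k (Suc m)"
    proof -
      have "\<forall>\<^sub>F m in sequentially. Suc n \<le> k m"
        using filterlim_geometric_index[OF c] by (simp add: filterlim_at_top k_def)
      then obtain m1 where "\<And>m. m \<ge> m1 \<Longrightarrow> Suc n \<le> k m" by (auto simp: eventually_sequentially)
      from this[of "Suc m1"] show ?thesis by (auto simp: Suc_le_eq)
    qed
    then have m: "n < k (Suc m)" unfolding m_def by (rule LeastI_ex)
    have kmono: "k a \<le> k b" if "a \<le> b" for a b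
      using mono_geometric_index[OF c] that by (auto simp: k_def mono_def)
    have "m \<ge> m0"
    proof (rule ccontr)
      assume "\<not> m \<ge> m0"
      then have "k (Suc m) \<le> k m0" by (intro kmono) auto
      then show False using m n by simp
    qed
    have "k m \<le> n"
    proof (cases "m = 0")
      case True
      then show ?thesis using kmono[of 0 m0] n by simp
    next
      case False
      then obtain m' where "m = Suc m'" by (cases m) auto
      then show ?thesis using not_less_Least[of m' "\<lambda>m. n < k (Suc m)"] by (simp add: m_def not_less)
    qed
    have n_pos: "real n > 0" using k_pos[of m] \<open>k m \<le> n\<close> by linarith
    have "T n / real n \<le> T (k (Suc m)) / real (k m)"
      using m \<open>k m \<le> n\<close> k_pos[of m] nonneg monoD[OF mono, of n "k (Suc m)"] by (intro frac_le) auto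
    also have "\<dots> < \<mu> * c + e / 2" using m0 \<open>m \<ge> m0\<close> by simp
    also have "\<dots> < \<mu> + e" using j(1) by (simp add: c_def mult.commute)
    finally have up: "T n / real n < \<mu> + e" .
    have "T n / real n \<ge> T (k m) / real (k (Suc m))"
      using m \<open>k m \<le> n\<close> n_pos nonneg monoD[OF mono, of "k m" n] by (intro frac_le) auto
    moreover have "T (k m) / real (k (Suc m)) > \<mu> / c - e / 2" using m0 \<open>m \<ge> m0\<close> by simp
    ultimately have "T n / real n > \<mu> - e" using j(2) by (simp add: c_def)
    with up show ?thesis by auto
  qed
  then show "\<exists>no. \<forall>n\<ge>no. norm (T n / real n - \<mu>) < e" by auto
qed

text \<open>
  The sum extends over those \<open>n\<close> with \<open>k n \<ge> x\<close>, where \<open>1 / k n\<close> decreases geometrically from about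
  \<open>1 / x\<close>; so the bound does not depend on \<open>x\<close>. This is what makes the truncated second moments in the
  strong law summable under a first moment assumption.
\<close>

lemma sum_geometric_index_tail_le:
  fixes x :: real
  assumes c: "c > 1" and x: "x \<ge> 0"
  shows "(\<Sum>n<m. if x \<le> real (geometric_index c n) then x / real (geometric_index c n) else 0)
    \<le> 2 * c / (c - 1)"
proof -
  \<comment> \<open>As \<open>x \<le> k n\<close> implies \<open>x \<le> 2 * c ^ n\<close>, each nonzero term is at most \<open>x / c ^ n\<close>, which is a fixed
    multiple of the decrease of \<open>h\<close>; the sum telescopes.\<close>
  define h where "h n = min 2 (x * (1 / c) ^ n)" for n
  have step: "(if x \<le> real (geometric_index c n) then x / real (geometric_index c n) else 0)
      \<le> c / (c - 1) * (h n - h (Suc n))" for n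
  proof -
    have dec: "h (Suc n) \<le> h n"
      unfolding h_def using c x by (intro min.mono mult_left_mono power_decreasing) auto
    show ?thesis
    proof (cases "x \<le> real (geometric_index c n)")
      case True
      note b = geometric_index_bounds[OF c, of n]
      have cn: "c ^ n \<ge> 1" using c by simp
      have "x \<le> 2 * c ^ n" using True b cn by linarith
      then have le2: "x * (1 / c) ^ n \<le> 2" using c by (simp add: field_simps)
      have "x * (1 / c) ^ Suc n \<le> x * (1 / c) ^ n"
        using c x by (intro mult_left_mono power_decreasing) auto
      then have "h n - h (Suc n) = x * (1 / c) ^ n - x * (1 / c) ^ Suc n"
        using le2 by (simp add: h_def)
      also have "\<dots> = (c - 1) / c * (x * (1 / c) ^ n)" using c by (simp add: field_simps)
      finally have "c / (c - 1) * (h n - h (Suc n)) = x * (1 / c) ^ n" using c by simp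
      moreover have "x / real (geometric_index c n) \<le> x / c ^ n"
        using b cn x by (intro divide_left_mono mult_pos_pos) linarith+
      ultimately show ?thesis using True by (simp add: power_divide)
    next
      case False
      then show ?thesis using dec c by simp
    qed
  qed
  have "(\<Sum>n<m. if x \<le> real (geometric_index c n) then x / real (geometric_index c n) else 0)
    \<le> (\<Sum>n<m. c / (c - 1) * (h n - h (Suc n)))"
    by (intro sum_mono step)
  also have "\<dots> = c / (c - 1) * (h 0 - h m)"
    by (simp only: sum_distrib_left[symmetric] sum_lessThan_telescope')
  also have "\<dots> \<le> c / (c - 1) * 2"
  proof (rule mult_left_mono)
    have "h m \<ge> 0" using c x by (simp add: h_def)
    moreover have "h 0 \<le> 2" by (simp add: h_def)
    ultimately show "h 0 - h m \<le> 2" by linarith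
  qed (use c in simp)
  finally show ?thesis by (simp add: mult_ac)
qed

section \<open>The strong law of large numbers for pairwise independent variables\<close>

text \<open>
  Serves twice in the strong law: for indicators it is the first Borel-Cantelli lemma, and for squared
  deviations it replaces Chebyshev's inequality followed by that lemma.
\<close>

lemma AE_tendsto_zero_of_summable_integral:
  fixes g :: "nat \<Rightarrow> 'a \<Rightarrow> real"
  assumes int: "\<And>n. integrable M (g n)" and nonneg: "\<And>n \<omega>. \<omega> \<in> space M \<Longrightarrow> g n \<omega> \<ge> 0"
    and bound: "\<And>m. (\<Sum>n<m. \<integral>\<omega>. g n \<omega> \<partial>M) \<le> C"
  shows "AE \<omega> in M. (\<lambda>n. g n \<omega>) \<longlonglongrightarrow> 0"
proof -
  have [measurable]: "g n \<in> borel_measurable M" for n using int[of n] by auto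
  have E: "(\<integral>\<^sup>+\<omega>. ennreal (g n \<omega>) \<partial>M) = ennreal (\<integral>\<omega>. g n \<omega> \<partial>M)" for n
    using int[of n] nonneg by (intro nn_integral_eq_integral) auto
  have pos: "0 \<le> (\<integral>\<omega>. g n \<omega> \<partial>M)" for n
    using nonneg by (intro integral_nonneg_AE) auto
  have "(\<integral>\<^sup>+\<omega>. (\<Sum>n. ennreal (g n \<omega>)) \<partial>M) = (\<Sum>n. ennreal (\<integral>\<omega>. g n \<omega> \<partial>M))"
    by (simp add: nn_integral_suminf E)
  also have "\<dots> \<le> ennreal C"
    using bound by (intro suminf_le_const) (auto simp: sum_ennreal pos intro!: ennreal_leI)
  finally have "(\<integral>\<^sup>+\<omega>. (\<Sum>n. ennreal (g n \<omega>)) \<partial>M) \<noteq> \<infinity>"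
    by (auto simp: top_unique)
  then have "AE \<omega> in M. (\<Sum>n. ennreal (g n \<omega>)) \<noteq> \<infinity>"
    by (intro nn_integral_PInf_AE) auto
  then show ?thesis
    using AE_space
  proof eventually_elim
    case (elim \<omega>)
    then have "summable (\<lambda>n. g n \<omega>)"
      using nonneg by (intro summable_suminf_not_top) auto
    then show ?case by (rule summable_LIMSEQ_zero)
  qed
qed

lemma expectation_square_sum_orthogonal:
  fixes D :: "'i \<Rightarrow> 'a \<Rightarrow> real"
  assumes "finite A" and "\<And>i j. i \<in> A \<Longrightarrow> j \<in> A \<Longrightarrow> integrable M (\<lambda>\<omega>. D i \<omega> * D j \<omega>)"
    and orth: "\<And>i j. i \<in> A \<Longrightarrow> j \<in> A \<Longrightarrow> i \<noteq> j \<Longrightarrow> (\<integral>\<omega>. D i \<omega> * D j \<omega> \<partial>M) = 0"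
  shows "(\<integral>\<omega>. (\<Sum>i\<in>A. D i \<omega>)\<^sup>2 \<partial>M) = (\<Sum>i\<in>A. \<integral>\<omega>. (D i \<omega>)\<^sup>2 \<partial>M)"
proof -
  have "(\<integral>\<omega>. (\<Sum>i\<in>A. D i \<omega>)\<^sup>2 \<partial>M) = (\<integral>\<omega>. (\<Sum>i\<in>A. \<Sum>j\<in>A. D i \<omega> * D j \<omega>) \<partial>M)"
    by (simp add: power2_eq_square sum_product)
  also have "\<dots> = (\<Sum>i\<in>A. \<Sum>j\<in>A. \<integral>\<omega>. D i \<omega> * D j \<omega> \<partial>M)"
    using assms by (simp add: Bochner_Integration.integral_sum)
  also have "\<dots> = (\<Sum>i\<in>A. \<Sum>j\<in>A. if i = j then \<integral>\<omega>. D i \<omega> * D i \<omega> \<partial>M else 0)"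
    by (intro sum.cong refl) (auto simp: orth)
  also have "\<dots> = (\<Sum>i\<in>A. \<integral>\<omega>. (D i \<omega>)\<^sup>2 \<partial>M)"
    using \<open>finite A\<close> by (simp add: power2_eq_square)
  finally show ?thesis .
qed

lemma integral_eq_of_same_distr:
  fixes \<phi> :: "'b \<Rightarrow> real"
  assumes "X \<in> measurable M N" "Y \<in> measurable M N" "distr M N X = distr M N Y"
    and "\<phi> \<in> borel_measurable N"
  shows "(\<integral>\<omega>. \<phi> (X \<omega>) \<partial>M) = (\<integral>\<omega>. \<phi> (Y \<omega>) \<partial>M)"
  using integral_distr[OF assms(1,4)] integral_distr[OF assms(2,4)] assms(3) by simp

definition truncate :: "nat \<Rightarrow> real \<Rightarrow> real" where
  "truncate n x = (if x \<le> real n then x else 0)"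

lemma truncate_measurable[measurable]: "truncate n \<in> borel_measurable borel"
  unfolding truncate_def[abs_def] by measurable

text \<open>
  Etemadi's argument. Truncating the \<open>i\<close>-th variable at \<open>i\<close> changes almost surely finitely many terms
  and makes second moments finite. Pairwise independence suffices for the variance of a sum to be the
  sum of the variances. Nonnegativity makes the partial sums monotone, so convergence along the
  sequences \<open>geometric_index c\<close> is enough.
\<close>

lemma (in prob_space) strong_law_nonneg:
  fixes X :: "nat \<Rightarrow> 'a \<Rightarrow> real"
  assumes indep: "\<And>i j. i \<noteq> j \<Longrightarrow> indep_var borel (X i) borel (X j)"
    and ident: "\<And>i. distr M borel (X i) = distr M borel (X 0)"
    and int: "integrable M (X 0)" and nonneg: "\<And>i \<omega>. X i \<omega> \<ge> 0"
  shows "AE \<omega> in M. (\<lambda>n. (\<Sum>i<n. X i \<omega>) / real n) \<longlonglongrightarrow> expectation (X 0)"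
proof -
  have rv[measurable]: "X i \<in> borel_measurable M" for i
    using indep_var_rv1[OF indep[of i "Suc i"]] by simp
  have transfer: "expectation (\<lambda>\<omega>. \<phi> (X i \<omega>)) = expectation (\<lambda>\<omega>. \<phi> (X 0 \<omega>))"
    if "\<phi> \<in> borel_measurable borel" for \<phi> :: "real \<Rightarrow> real" and i
    by (rule integral_eq_of_same_distr[OF rv rv ident that])
  define \<mu> where "\<mu> = expectation (X 0)"
  define Y where "Y i \<omega> = truncate i (X i \<omega>)" for i \<omega>
  define a where "a i = expectation (Y i)" for i
  define D where "D i \<omega> = Y i \<omega> - a i" for i \<omega>
  have [measurable]: "Y i \<in> borel_measurable M" "D i \<in> borel_measurable M" for i
    by (simp_all add: Y_def[abs_def] D_def[abs_def])
  have trunc_bound: "0 \<le> truncate n x" "truncate n x \<le> real n" "truncate n x \<le> x" if "x \<ge> 0" for n x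
    using that by (auto simp: truncate_def)

  \<comment> \<open>The number of indices \<open>i\<close> with \<open>i < x\<close> is at most \<open>x + 1\<close>, so the probabilities of
    \<open>X i > i\<close> sum to at most \<open>\<mu> + 1\<close>.\<close>
  have "AE \<omega> in M. (\<lambda>i. of_bool (real i < X i \<omega>) :: real) \<longlonglongrightarrow> 0"
  proof (rule AE_tendsto_zero_of_summable_integral)
    fix m
    have count: "(\<Sum>i<m. of_bool (real i < x)) \<le> min (real m) (x + 1)" if "x \<ge> 0" for x
      by (induction m) (use that in auto)
    have "expectation (\<lambda>\<omega>. of_bool (real i < X i \<omega>) :: real) = expectation (\<lambda>\<omega>. of_bool (real i < X 0 \<omega>))" for i
      by (rule transfer[of "\<lambda>x. of_bool (real i < x)"]) simp
    then have "(\<Sum>i<m. expectation (\<lambda>\<omega>. of_bool (real i < X i \<omega>) :: real))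
        = (\<Sum>i<m. expectation (\<lambda>\<omega>. of_bool (real i < X 0 \<omega>)))"
      by simp
    also have "\<dots> = expectation (\<lambda>\<omega>. \<Sum>i<m. of_bool (real i < X 0 \<omega>))"
      by (rule Bochner_Integration.integral_sum[symmetric])
         (auto intro!: integrable_const_bound[where B = 1])
    also have "\<dots> \<le> expectation (\<lambda>\<omega>. X 0 \<omega> + 1)"
    proof (rule integral_mono)
      show "integrable M (\<lambda>\<omega>. \<Sum>i<m. of_bool (real i < X 0 \<omega>) :: real)"
        by (intro Bochner_Integration.integrable_sum integrable_const_bound[where B = 1]) auto
      show "integrable M (\<lambda>\<omega>. X 0 \<omega> + 1)" using int by auto
      show "(\<Sum>i<m. of_bool (real i < X 0 \<omega>)) \<le> X 0 \<omega> + 1" for \<omega>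
        using count[OF nonneg[of 0 \<omega>]] by simp
    qed
    finally show "(\<Sum>i<m. expectation (\<lambda>\<omega>. of_bool (real i < X i \<omega>)))
        \<le> expectation (\<lambda>\<omega>. X 0 \<omega> + 1)" .
  qed (auto intro!: integrable_const_bound[where B = 1])
  then have trunc: "AE \<omega> in M. (\<lambda>i. X i \<omega> - Y i \<omega>) \<longlonglongrightarrow> 0"
  proof eventually_elim
    case (elim \<omega>)
    then have "\<forall>\<^sub>F i in sequentially. of_bool (real i < X i \<omega>) < (1 :: real)"
      by (rule order_tendstoD) simp
    then have "\<forall>\<^sub>F i in sequentially. X i \<omega> - Y i \<omega> = 0"
      by eventually_elim (auto simp: Y_def truncate_def split: if_splits)
    then show ?case by (rule tendsto_eventually)
  qed

  have "a \<longlonglongrightarrow> \<mu>"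
  proof -
    have "(\<lambda>i. expectation (\<lambda>\<omega>. truncate i (X 0 \<omega>))) \<longlonglongrightarrow> \<mu>"
      unfolding \<mu>_def
    proof (rule integral_dominated_convergence)
      show "AE \<omega> in M. (\<lambda>i. truncate i (X 0 \<omega>)) \<longlonglongrightarrow> X 0 \<omega>"
      proof (rule AE_I2, rule tendsto_eventually)
        fix \<omega>
        show "\<forall>\<^sub>F i in sequentially. truncate i (X 0 \<omega>) = X 0 \<omega>"
          using eventually_ge_at_top[of "nat \<lceil>X 0 \<omega>\<rceil>"]
          by eventually_elim (auto simp: truncate_def)
      qed
      show "AE \<omega> in M. norm (truncate i (X 0 \<omega>)) \<le> X 0 \<omega>" for i
        using trunc_bound nonneg by auto
    qed (use int in auto)
    moreover have "a = (\<lambda>i. expectation (\<lambda>\<omega>. truncate i (X 0 \<omega>)))"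
      unfolding a_def Y_def by (intro ext transfer) simp
    ultimately show ?thesis by simp
  qed
  then have means: "(\<lambda>n. (\<Sum>i<n. a i) / real n) \<longlonglongrightarrow> \<mu>" by (rule cesaro_mean)

  have Y_int: "integrable M (Y i)" for i
    by (rule integrable_const_bound[where B = "real i"]) (use trunc_bound nonneg in \<open>auto simp: Y_def\<close>)
  have D_bound: "\<bar>D i \<omega>\<bar> \<le> real i + \<bar>a i\<bar>" for i \<omega>
    using trunc_bound[OF nonneg[of i \<omega>], of i] by (auto simp: D_def Y_def)
  have D_int: "integrable M (D i)" for i
    unfolding D_def[abs_def] using Y_int by auto
  have D_mean: "expectation (D i) = 0" for i
    using Y_int[of i] by (simp add: D_def[abs_def] a_def prob_space)
  have DD_int: "integrable M (\<lambda>\<omega>. D i \<omega> * D j \<omega>)" for i j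
    by (rule integrable_const_bound[where B = "(real i + \<bar>a i\<bar>) * (real j + \<bar>a j\<bar>)"])
       (auto simp: abs_mult intro!: mult_mono D_bound)
  have DD_orth: "expectation (\<lambda>\<omega>. D i \<omega> * D j \<omega>) = 0" if "i \<noteq> j" for i j
  proof -
    have "indep_var borel ((\<lambda>x. truncate i x - a i) \<circ> X i) borel ((\<lambda>x. truncate j x - a j) \<circ> X j)"
      by (rule indep_var_compose[OF indep[OF that]]) simp_all
    then have "indep_var borel (D i) borel (D j)"
      by (simp add: D_def[abs_def] Y_def o_def)
    from indep_var_lebesgue_integral[OF this D_int D_int] show ?thesis by (simp add: D_mean)
  qed
  have D_var: "expectation (\<lambda>\<omega>. (D i \<omega>)\<^sup>2) \<le> expectation (\<lambda>\<omega>. (truncate k (X 0 \<omega>))\<^sup>2)"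
    if "i \<le> k" for i k
  proof -
    have sq_int: "integrable M (\<lambda>\<omega>. (truncate n (X j \<omega>))\<^sup>2)" for n j
      by (rule integrable_const_bound[where B = "(real n)\<^sup>2"])
         (use trunc_bound nonneg in \<open>auto intro!: power_mono\<close>)
    have "expectation (\<lambda>\<omega>. (D i \<omega>)\<^sup>2) = expectation (\<lambda>\<omega>. (Y i \<omega>)\<^sup>2) - (a i)\<^sup>2"
      unfolding D_def a_def using variance_eq[OF Y_int[of i]] sq_int[of i i] by (simp add: Y_def)
    also have "\<dots> \<le> expectation (\<lambda>\<omega>. (Y i \<omega>)\<^sup>2)" by simp
    also have "\<dots> = expectation (\<lambda>\<omega>. (truncate i (X 0 \<omega>))\<^sup>2)"
      unfolding Y_def by (rule transfer) simp
    also have "\<dots> \<le> expectation (\<lambda>\<omega>. (truncate k (X 0 \<omega>))\<^sup>2)"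
      using that by (intro integral_mono sq_int) (auto simp: truncate_def)
    finally show ?thesis .
  qed

  have along: "AE \<omega> in M. (\<lambda>n. (\<Sum>i<geometric_index c n. X i \<omega>) / real (geometric_index c n)) \<longlonglongrightarrow> \<mu>"
    if c: "c > 1" for c :: real
  proof -
    define k where "k = geometric_index c"
    have k_pos: "real (k n) > 0" for n
      using geometric_index_bounds(3)[OF c, of n] by (simp add: k_def)
    have k_lim: "filterlim k at_top sequentially"
      unfolding k_def by (rule filterlim_geometric_index[OF c])
    define C where "C = 2 * c / (c - 1)"
    have tr_int: "integrable M (\<lambda>\<omega>. (truncate n (X 0 \<omega>))\<^sup>2 / real n)" for n
      by (rule integrable_const_bound[where B = "(real n)\<^sup>2 / real n"])
         (use trunc_bound nonneg in \<open>auto intro!: power_mono divide_right_mono\<close>)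
    have "AE \<omega> in M. (\<lambda>n. ((\<Sum>i<k n. D i \<omega>) / real (k n))\<^sup>2) \<longlonglongrightarrow> 0"
    proof (rule AE_tendsto_zero_of_summable_integral)
      show "integrable M (\<lambda>\<omega>. ((\<Sum>i<k n. D i \<omega>) / real (k n))\<^sup>2)" for n
      proof -
        have "integrable M (\<lambda>\<omega>. \<Sum>i<k n. \<Sum>j<k n. D i \<omega> * D j \<omega>)"
          by (intro Bochner_Integration.integrable_sum DD_int)
        then have "integrable M (\<lambda>\<omega>. (\<Sum>i<k n. \<Sum>j<k n. D i \<omega> * D j \<omega>) / (real (k n))\<^sup>2)"
          by (rule Bochner_Integration.integrable_divide)
        moreover have "((\<Sum>i<k n. D i \<omega>) / real (k n))\<^sup>2
            = (\<Sum>i<k n. \<Sum>j<k n. D i \<omega> * D j \<omega>) / (real (k n))\<^sup>2" for \<omega>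
          unfolding power_divide by (simp only: power2_eq_square sum_product)
        ultimately show ?thesis by simp
      qed
      fix m
      have "expectation (\<lambda>\<omega>. ((\<Sum>i<k n. D i \<omega>) / real (k n))\<^sup>2)
          \<le> expectation (\<lambda>\<omega>. (truncate (k n) (X 0 \<omega>))\<^sup>2 / real (k n))" for n
      proof -
        have "expectation (\<lambda>\<omega>. ((\<Sum>i<k n. D i \<omega>) / real (k n))\<^sup>2)
          = (\<Sum>i<k n. expectation (\<lambda>\<omega>. (D i \<omega>)\<^sup>2)) / (real (k n))\<^sup>2"
          by (simp add: power_divide expectation_square_sum_orthogonal DD_int DD_orth)
        also have "\<dots> \<le> (\<Sum>i<k n. expectation (\<lambda>\<omega>. (truncate (k n) (X 0 \<omega>))\<^sup>2)) / (real (k n))\<^sup>2"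
          by (intro divide_right_mono sum_mono D_var) auto
        also have "\<dots> = expectation (\<lambda>\<omega>. (truncate (k n) (X 0 \<omega>))\<^sup>2 / real (k n))"
          using k_pos[of n] by (simp add: power2_eq_square field_simps)
        finally show ?thesis .
      qed
      \<comment> \<open>Summing over \<open>n\<close> inside the expectation, each value \<open>x\<close> of \<open>X 0\<close> contributes
        \<open>x\<^sup>2\<close> times the sum of \<open>1 / k n\<close> over \<open>k n \<ge> x\<close>, which is of order \<open>x\<close>.\<close>
      then have "(\<Sum>n<m. expectation (\<lambda>\<omega>. ((\<Sum>i<k n. D i \<omega>) / real (k n))\<^sup>2))
          \<le> (\<Sum>n<m. expectation (\<lambda>\<omega>. (truncate (k n) (X 0 \<omega>))\<^sup>2 / real (k n)))"
        by (rule sum_mono)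
      also have "\<dots> = expectation (\<lambda>\<omega>. \<Sum>n<m. (truncate (k n) (X 0 \<omega>))\<^sup>2 / real (k n))"
        by (rule Bochner_Integration.integral_sum[symmetric]) (rule tr_int)
      also have "\<dots> \<le> expectation (\<lambda>\<omega>. C * X 0 \<omega>)"
      proof (rule integral_mono)
        show "integrable M (\<lambda>\<omega>. \<Sum>n<m. (truncate (k n) (X 0 \<omega>))\<^sup>2 / real (k n))"
          by (intro Bochner_Integration.integrable_sum tr_int)
        show "integrable M (\<lambda>\<omega>. C * X 0 \<omega>)" using int by simp
        fix \<omega>
        let ?x = "X 0 \<omega>"
        have "(\<Sum>n<m. (truncate (k n) ?x)\<^sup>2 / real (k n))
           = ?x * (\<Sum>n<m. if ?x \<le> real (k n) then ?x / real (k n) else 0)"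
          unfolding sum_distrib_left
          by (intro sum.cong refl) (simp add: truncate_def power2_eq_square)
        also have "\<dots> \<le> ?x * C"
          unfolding C_def k_def
          by (intro mult_left_mono sum_geometric_index_tail_le[OF c] nonneg)
        finally show "(\<Sum>n<m. (truncate (k n) ?x)\<^sup>2 / real (k n)) \<le> C * ?x" by (simp add: mult.commute)
      qed
      finally show "(\<Sum>n<m. expectation (\<lambda>\<omega>. ((\<Sum>i<k n. D i \<omega>) / real (k n))\<^sup>2))
          \<le> expectation (\<lambda>\<omega>. C * X 0 \<omega>)" .
    qed auto
    with trunc show ?thesis
    proof eventually_elim
      case (elim \<omega>)
      have "(\<lambda>n. sqrt (((\<Sum>i<k n. D i \<omega>) / real (k n))\<^sup>2)) \<longlonglongrightarrow> sqrt 0"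
        by (intro tendsto_real_sqrt elim)
      then have 1: "(\<lambda>n. (\<Sum>i<k n. D i \<omega>) / real (k n)) \<longlonglongrightarrow> 0"
        unfolding real_sqrt_abs real_sqrt_zero by (rule tendsto_rabs_zero_cancel)
      have 2: "(\<lambda>n. (\<Sum>i<k n. a i) / real (k n)) \<longlonglongrightarrow> \<mu>"
        by (rule filterlim_compose[OF means k_lim])
      have 3: "(\<lambda>n. (\<Sum>i<k n. X i \<omega> - Y i \<omega>) / real (k n)) \<longlonglongrightarrow> 0"
        by (rule filterlim_compose[OF cesaro_mean[OF elim(1)] k_lim])
      have "(\<Sum>i<k n. X i \<omega>) / real (k n) = (\<Sum>i<k n. D i \<omega>) / real (k n) + (\<Sum>i<k n. a i) / real (k n)
          + (\<Sum>i<k n. X i \<omega> - Y i \<omega>) / real (k n)" for n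
        by (simp add: D_def sum_subtractf add_divide_distrib diff_divide_distrib)
      then show ?case using tendsto_add[OF tendsto_add[OF 1 2] 3] by (simp add: k_def)
    qed
  qed
  have "AE \<omega> in M. \<forall>j. (\<lambda>n. (\<Sum>i<geometric_index (1 + 1 / real (Suc j)) n. X i \<omega>) /
      real (geometric_index (1 + 1 / real (Suc j)) n)) \<longlonglongrightarrow> \<mu>"
    unfolding AE_all_countable by (intro allI along) simp
  then show ?thesis
    unfolding \<mu>_def[symmetric]
  proof eventually_elim
    case (elim \<omega>)
    show ?case
      by (rule mono_mean_tendsto_from_geometric[OF _ _ elim[rule_format]])
         (auto intro!: monoI sum_mono2 sum_nonneg nonneg)
  qed
qed

lemma (in prob_space) strong_law_pairwise_independent:
  fixes X :: "nat \<Rightarrow> 'a \<Rightarrow> real"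
  assumes indep: "\<And>i j. i \<noteq> j \<Longrightarrow> indep_var borel (X i) borel (X j)"
    and ident: "\<And>i. distr M borel (X i) = distr M borel (X 0)"
    and int: "integrable M (X 0)"
  shows "AE \<omega> in M. (\<lambda>n. (\<Sum>i<n. X i \<omega>) / real n) \<longlonglongrightarrow> expectation (X 0)"
proof -
  have rv[measurable]: "X i \<in> borel_measurable M" for i
    using indep_var_rv1[OF indep[of i "Suc i"]] by simp
  have part: "AE \<omega> in M. (\<lambda>n. (\<Sum>i<n. max 0 (s * X i \<omega>)) / real n) \<longlonglongrightarrow> expectation (\<lambda>\<omega>. max 0 (s * X 0 \<omega>))"
    for s :: real
  proof (rule strong_law_nonneg)
    show "indep_var borel (\<lambda>\<omega>. max 0 (s * X i \<omega>)) borel (\<lambda>\<omega>. max 0 (s * X j \<omega>))" if "i \<noteq> j" for i j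
      using indep_var_compose[OF indep[OF that], of "\<lambda>x. max 0 (s * x)" borel "\<lambda>x. max 0 (s * x)" borel]
      by (simp add: o_def)
    show "distr M borel (\<lambda>\<omega>. max 0 (s * X i \<omega>)) = distr M borel (\<lambda>\<omega>. max 0 (s * X 0 \<omega>))" for i
      using arg_cong[OF ident[of i], of "\<lambda>N. distr N borel (\<lambda>x. max 0 (s * x))"]
      by (simp add: distr_distr o_def)
    show "integrable M (\<lambda>\<omega>. max 0 (s * X 0 \<omega>))" using int by auto
  qed simp
  have split: "x = max 0 (1 * x) - max 0 (-1 * x)" for x :: real by auto
  have "expectation (X 0) = expectation (\<lambda>\<omega>. max 0 (1 * X 0 \<omega>) - max 0 (-1 * X 0 \<omega>))"
    by (intro Bochner_Integration.integral_cong refl split)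
  also have "\<dots> = expectation (\<lambda>\<omega>. max 0 (1 * X 0 \<omega>)) - expectation (\<lambda>\<omega>. max 0 (-1 * X 0 \<omega>))"
    by (rule Bochner_Integration.integral_diff) (use int in auto)
  finally have E: "expectation (X 0) = \<dots>" .
  from part[of 1] part[of "-1"] show ?thesis
  proof eventually_elim
    case (elim \<omega>)
    have "(\<Sum>i<n. X i \<omega>) / real n = (\<Sum>i<n. max 0 (1 * X i \<omega>)) / real n - (\<Sum>i<n. max 0 (-1 * X i \<omega>)) / real n" for n
      unfolding diff_divide_distrib[symmetric] sum_subtractf[symmetric]
      by (intro arg_cong[where f = "\<lambda>x. x / real n"] sum.cong refl split)
    then show ?case using tendsto_diff[OF elim] by (simp only: E)
  qed
qed

section \<open>Time integrals as limits over countably many times\<close>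

lemma (in prob_space) indep_var_of_indep_vars:
  assumes "indep_vars M' X I" "i \<in> I" "j \<in> I" "i \<noteq> j"
  shows "indep_var (M' i) (X i) (M' j) (X j)"
proof -
  have rv: "random_variable (M' i) (X i)" "random_variable (M' j) (X j)"
    using assms by (auto simp: indep_vars_def2)
  let ?E = "\<lambda>i. {X i -` A \<inter> space M |A. A \<in> sets (M' i)}"
  have E: "?E k = sets (vimage_algebra (space M) (X k) (M' k))" if "random_variable (M' k) (X k)" for k
    using measurable_space[OF that] by (subst sets_vimage_algebra2) auto
  have sig: "sigma_sets (space M) (?E k) = ?E k" if "random_variable (M' k) (X k)" for k
    using sets.sigma_sets_eq[of "vimage_algebra (space M) (X k) (M' k)"] by (simp add: E[OF that])
  have "indep_set (?E i) (?E j)"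
  proof (rule indep_setI)
    show "?E i \<subseteq> events" "?E j \<subseteq> events" using rv by (auto intro: measurable_sets)
  next
    fix a b assume "a \<in> ?E i" "b \<in> ?E j"
    then obtain A B where AB: "A \<in> sets (M' i)" "B \<in> sets (M' j)"
      and ab: "a = X i -` A \<inter> space M" "b = X j -` B \<inter> space M" by auto
    define C where "C = (\<lambda>k. if k = i then A else B)"
    have "prob (\<Inter>k\<in>{i, j}. X k -` C k \<inter> space M) = (\<Prod>k\<in>{i, j}. prob (X k -` C k \<inter> space M))"
      by (rule indep_varsD[OF assms(1)]) (use assms AB in \<open>auto simp: C_def\<close>)
    then show "prob (a \<inter> b) = prob a * prob b" using assms(4) by (simp add: C_def ab)
  qed
  then show ?thesis using rv by (simp add: indep_var_eq sig)
qed

lemma indep_vars_PiM_coordinates: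
  assumes "prob_space Q"
  shows "prob_space.indep_vars (PiM UNIV (\<lambda>_::nat. Q)) (\<lambda>_. Q) (\<lambda>i v. v i) UNIV"
proof -
  interpret P: prob_space "PiM UNIV (\<lambda>_::nat. Q)" by (rule prob_space_PiM) (rule assms)
  have "distr (PiM UNIV (\<lambda>_::nat. Q)) Q (\<lambda>v. v i) = Q" for i
    by (rule distr_PiM_component) (simp_all add: assms)
  then show ?thesis
    by (subst P.indep_vars_iff_distr_eq_PiM) (auto simp: distr_id2 restrict_UNIV)
qed

text \<open>
  The factor \<open>exp\<close> is the reciprocal of the density of the nodes, so that \<open>exp (v i) * h (v i)\<close> has
  expectation \<open>\<integral>h\<close>. An exponential law is chosen because it has a positive density on the whole half-line.
\<close>

lemma monte_carlo_integration:
  fixes h :: "real \<Rightarrow> real"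
  assumes int: "integrable lborel h" and supp: "\<And>u. u < 0 \<Longrightarrow> h u = 0"
  shows "AE v in PiM UNIV (\<lambda>_::nat. density lborel (exponential_density 1)).
    (\<lambda>N. (\<Sum>i<N. exp (v i) * h (v i)) / real N) \<longlonglongrightarrow> (\<integral>u. h u \<partial>lborel)"
proof -
  define Q where "Q = density lborel (exponential_density 1)"
  define P where "P = PiM UNIV (\<lambda>_::nat. Q)"
  have Q: "prob_space Q" unfolding Q_def by (rule prob_space_exponential_density) simp
  have sets_Q[simp]: "sets Q = sets borel" by (simp add: Q_def)
  interpret P: prob_space P unfolding P_def by (rule prob_space_PiM) (rule Q)
  have [measurable]: "h \<in> borel_measurable borel" using int by auto
  define g where "g u = exp u * h u" for u
  have g[measurable]: "g \<in> borel_measurable borel" unfolding g_def[abs_def] by measurable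
  have weight: "exponential_density 1 u * g u = h u" for u
    using supp[of u] by (simp add: exponential_density_def g_def mult.assoc[symmetric] exp_add[symmetric])
  have g_int: "integrable Q g"
    unfolding Q_def by (subst integrable_density) (auto simp: weight int)
  have g_mean: "(\<integral>u. g u \<partial>Q) = (\<integral>u. h u \<partial>lborel)"
    unfolding Q_def by (subst integral_density) (auto simp: weight)
  have coord: "distr P Q (\<lambda>v. v i) = Q" for i
    unfolding P_def by (rule distr_PiM_component) (simp_all add: Q)
  have [measurable]: "(\<lambda>v. v i) \<in> measurable P Q" for i unfolding P_def by simp
  have g'[measurable]: "g \<in> borel_measurable Q" using g by (simp add: measurable_cong_sets[OF sets_Q])
  have law: "distr P borel (\<lambda>v. g (v i)) = distr Q borel g" for i
    using distr_distr[of g Q borel "\<lambda>v. v i" P] by (simp add: coord o_def)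
  have "AE v in P. (\<lambda>N. (\<Sum>i<N. g (v i)) / real N) \<longlonglongrightarrow> P.expectation (\<lambda>v. g (v 0))"
  proof (rule P.strong_law_pairwise_independent)
    have "P.indep_vars (\<lambda>_. borel) (\<lambda>i v. g (v i)) UNIV"
      using indep_vars_PiM_coordinates[OF Q] unfolding P_def[symmetric]
      by (rule P.indep_vars_compose2) simp
    then show "P.indep_var borel (\<lambda>v. g (v i)) borel (\<lambda>v. g (v j))" if "i \<noteq> j" for i j
      using P.indep_var_of_indep_vars[of "\<lambda>_. borel" "\<lambda>i v. g (v i)" UNIV i j] that by simp
    show "integrable P (\<lambda>v. g (v 0))"
      using g_int integrable_distr_eq[of "\<lambda>v. v 0" P Q g] by (simp add: coord)
  qed (simp add: law)
  moreover have "P.expectation (\<lambda>v. g (v 0)) = (\<integral>u. h u \<partial>lborel)"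
    using integral_distr[of "\<lambda>v. v 0" P Q g] by (simp add: coord g_mean)
  ultimately show ?thesis unfolding P_def Q_def by (simp add: g_def)
qed

lemma sets_Collect_LIMSEQ:
  fixes g :: "nat \<Rightarrow> 'a \<Rightarrow> real"
  assumes [measurable]: "\<And>n. g n \<in> borel_measurable M" "L \<in> borel_measurable M"
  shows "{x \<in> space M. (\<lambda>n. g n x) \<longlonglongrightarrow> L x} \<in> sets M"
proof -
  have "(X \<longlonglongrightarrow> l) \<longleftrightarrow> (\<forall>k. \<exists>n0. \<forall>n\<ge>n0. \<bar>X n - l\<bar> < inverse (real (Suc k)))" for X :: "nat \<Rightarrow> real" and l
  proof
    assume lim: "X \<longlonglongrightarrow> l"
    show "\<forall>k. \<exists>n0. \<forall>n\<ge>n0. \<bar>X n - l\<bar> < inverse (real (Suc k))"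
    proof
      fix k
      have "inverse (real (Suc k)) > 0" by simp
      from LIMSEQ_D[OF lim this] show "\<exists>n0. \<forall>n\<ge>n0. \<bar>X n - l\<bar> < inverse (real (Suc k))"
        by (simp only: real_norm_def)
    qed
  next
    assume *: "\<forall>k. \<exists>n0. \<forall>n\<ge>n0. \<bar>X n - l\<bar> < inverse (real (Suc k))"
    show "X \<longlonglongrightarrow> l"
    proof (rule LIMSEQ_I)
      fix e :: real assume "e > 0"
      then obtain k where k: "inverse (real (Suc k)) < e" using reals_Archimedean by blast
      from * obtain n0 where "\<forall>n\<ge>n0. \<bar>X n - l\<bar> < inverse (real (Suc k))" by blast
      then show "\<exists>no. \<forall>n\<ge>no. norm (X n - l) < e"
        unfolding real_norm_def using k less_trans by blast
    qed
  qed
  then show ?thesis by simp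
qed

text \<open>
  For fixed \<open>\<omega>\<close> almost every node sequence integrates \<open>H n \<cdot> \<omega>\<close>. By Fubini's theorem almost every node
  sequence integrates \<open>H n \<cdot> \<omega>\<close> for almost every \<open>\<omega>\<close>. As there are countably many \<open>n\<close>, one node sequence
  serves them all.
\<close>

lemma (in prob_space) common_quadrature_nodes:
  fixes H :: "nat \<Rightarrow> real \<Rightarrow> 'a \<Rightarrow> real"
  assumes meas: "\<And>n. (\<lambda>(t, \<omega>). H n t \<omega>) \<in> borel_measurable (borel \<Otimes>\<^sub>M M)"
    and supp: "\<And>n t \<omega>. t < 0 \<Longrightarrow> H n t \<omega> = 0"
    and int: "\<And>n. AE \<omega> in M. integrable lborel (\<lambda>t. H n t \<omega>)"
  obtains u :: "nat \<Rightarrow> real" where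
    "\<And>n. AE \<omega> in M. (\<lambda>N. (\<Sum>i<N. exp (u i) * H n (u i) \<omega>) / real N) \<longlonglongrightarrow> (\<integral>t. H n t \<omega> \<partial>lborel)"
proof -
  define Q where "Q = density lborel (exponential_density 1)"
  define P where "P = PiM UNIV (\<lambda>_::nat. Q)"
  have Q: "prob_space Q" unfolding Q_def by (rule prob_space_exponential_density) simp
  have sets_Q: "sets Q = sets borel" by (simp add: Q_def)
  interpret P: prob_space P unfolding P_def by (rule prob_space_PiM) (rule Q)
  interpret pair_sigma_finite M P ..
  note meas[measurable]
  let ?conv = "\<lambda>n \<omega> v. (\<lambda>N. (\<Sum>i<N. exp (v i) * H n (v i) \<omega>) / real N) \<longlonglongrightarrow> (\<integral>t. H n t \<omega> \<partial>lborel)"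
  have "AE v in P. AE \<omega> in M. ?conv n \<omega> v" for n
  proof -
    have "AE \<omega> in M. AE v in P. ?conv n \<omega> v"
      using int[of n]
    proof eventually_elim
      case (elim \<omega>)
      show ?case
        unfolding P_def Q_def by (rule monte_carlo_integration[OF elim]) (rule supp)
    qed
    moreover have "{x \<in> space (M \<Otimes>\<^sub>M P). ?conv n (fst x) (snd x)} \<in> sets (M \<Otimes>\<^sub>M P)"
    proof (rule sets_Collect_LIMSEQ)
      have [measurable]: "(\<lambda>v. v i) \<in> borel_measurable P" for i
        using measurable_component_singleton[of i UNIV "\<lambda>_. Q"]
        unfolding P_def measurable_cong_sets[OF refl sets_Q] by simp
      show "(\<lambda>x. (\<Sum>i<N. exp (snd x i) * H n (snd x i) (fst x)) / real N) \<in> borel_measurable (M \<Otimes>\<^sub>M P)" for N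
        by measurable
      show "(\<lambda>x. \<integral>t. H n t (fst x) \<partial>lborel) \<in> borel_measurable (M \<Otimes>\<^sub>M P)"
        by measurable
    qed
    ultimately show ?thesis by (simp add: AE_commute)
  qed
  then have "AE v in P. \<forall>n. AE \<omega> in M. ?conv n \<omega> v" by (simp add: AE_all_countable)
  then obtain u where "\<forall>n. AE \<omega> in M. ?conv n \<omega> u"
    using eventually_happens'[OF P.ae_filter_bot] by blast
  then show thesis by (intro that) auto
qed

section \<open>The cycles as independent random elements\<close>

text \<open>
  Independence of two random elements whose values have different types is expressed here through
  rectangles.
\<close>

lemma distr_pair_indep:
  assumes "prob_space M" and [measurable]: "X \<in> measurable M N" "Y \<in> measurable M K"
    and indep: "\<And>A C. A \<in> sets N \<Longrightarrow> C \<in> sets K \<Longrightarrow>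
      measure M ((X -` A \<inter> space M) \<inter> (Y -` C \<inter> space M))
        = measure M (X -` A \<inter> space M) * measure M (Y -` C \<inter> space M)"
  shows "distr M (N \<Otimes>\<^sub>M K) (\<lambda>\<omega>. (X \<omega>, Y \<omega>)) = distr M N X \<Otimes>\<^sub>M distr M K Y"
proof -
  interpret prob_space M by fact
  interpret DX: prob_space "distr M N X" by (rule prob_space_distr) simp
  interpret DY: prob_space "distr M K Y" by (rule prob_space_distr) simp
  show ?thesis
  proof (rule pair_measure_eqI[symmetric])
    fix A C assume "A \<in> sets (distr M N X)" "C \<in> sets (distr M K Y)"
    then have [measurable]: "A \<in> sets N" "C \<in> sets K" by auto
    have "(\<lambda>\<omega>. (X \<omega>, Y \<omega>)) -` (A \<times> C) \<inter> space M = (X -` A \<inter> space M) \<inter> (Y -` C \<inter> space M)" by auto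
    then show "emeasure (distr M N X) A * emeasure (distr M K Y) C
        = emeasure (distr M (N \<Otimes>\<^sub>M K) (\<lambda>\<omega>. (X \<omega>, Y \<omega>))) (A \<times> C)"
      by (simp add: emeasure_distr emeasure_eq_measure indep ennreal_mult)
  qed (auto simp: DX.sigma_finite_measure DY.sigma_finite_measure
         intro: DX.sigma_finite_measure_axioms DY.sigma_finite_measure_axioms cong: sets_pair_measure_cong)
qed

context resetting begin

definition cycle :: "nat \<Rightarrow> 'a \<Rightarrow> real \<times> (real \<Rightarrow> real)" where
  "cycle n \<omega> = (S n \<omega>, sample_path B n \<omega>)"

abbreviation cycle_space :: "(real \<times> (real \<Rightarrow> real)) measure" where
  "cycle_space \<equiv> borel \<Otimes>\<^sub>M path_space"

lemma S_rv: "n \<ge> 1 \<Longrightarrow> S n \<in> borel_measurable M"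
  using S_indep by (simp add: indep_vars_def2)

lemma path_rv: "n \<ge> 1 \<Longrightarrow> sample_path B n \<in> measurable M path_space"
  using B_indep by (simp add: indep_vars_def2)

lemma cycle_rv: "n \<ge> 1 \<Longrightarrow> cycle n \<in> measurable M cycle_space"
  unfolding cycle_def[abs_def] by (intro measurable_Pair S_rv path_rv)

abbreviation waiting_events :: "'a set set" where
  "waiting_events \<equiv> sets (vimage_algebra (space M) (\<lambda>\<omega>. \<lambda>n\<in>{1..}. S n \<omega>) (\<Pi>\<^sub>M n\<in>{1..}. borel))"

abbreviation path_events :: "'a set set" where
  "path_events \<equiv> sets (vimage_algebra (space M) (\<lambda>\<omega>. \<lambda>n\<in>{1..}. sample_path B n \<omega>)
      (\<Pi>\<^sub>M n\<in>{1..}. path_space))"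

lemma waiting_event:
  assumes "n \<ge> 1" "A \<in> sets borel"
  shows "S n -` A \<inter> space M \<in> waiting_events"
proof -
  let ?f = "\<lambda>\<omega>. \<lambda>n\<in>{1..}. S n \<omega>" and ?P = "(\<Pi>\<^sub>M n\<in>{1::nat..}. borel) :: (nat \<Rightarrow> real) measure"
  have "(\<lambda>x. x n) -` A \<inter> space ?P \<in> sets ?P"
    using assms by (intro measurable_sets[OF measurable_component_singleton]) auto
  then have "?f -` ((\<lambda>x. x n) -` A \<inter> space ?P) \<inter> space M \<in> waiting_events"
    by (rule in_vimage_algebra)
  also have "?f -` ((\<lambda>x. x n) -` A \<inter> space ?P) \<inter> space M = S n -` A \<inter> space M"
    using assms(1) by (auto simp: space_PiM)
  finally show ?thesis .
qed

lemma path_event: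
  assumes "n \<ge> 1" "C \<in> sets path_space"
  shows "sample_path B n -` C \<inter> space M \<in> path_events"
proof -
  let ?f = "\<lambda>\<omega>. \<lambda>n\<in>{1..}. sample_path B n \<omega>" and ?P = "(\<Pi>\<^sub>M n\<in>{1::nat..}. path_space)"
  have "(\<lambda>x. x n) -` C \<inter> space ?P \<in> sets ?P"
    using assms by (intro measurable_sets[OF measurable_component_singleton]) auto
  then have "?f -` ((\<lambda>x. x n) -` C \<inter> space ?P) \<inter> space M \<in> path_events"
    by (rule in_vimage_algebra)
  also have "?f -` ((\<lambda>x. x n) -` C \<inter> space ?P) \<inter> space M = sample_path B n -` C \<inter> space M"
    using assms(1) by (auto simp: space_PiM sample_path_def)
  finally show ?thesis .
qed

lemma cycle_law:
  assumes "n \<ge> 1"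
  shows "distr M cycle_space (cycle n) = distr M cycle_space (cycle 1)"
proof -
  have "distr M cycle_space (cycle k) = distr M borel (S k) \<Otimes>\<^sub>M distr M path_space (sample_path B k)"
    if k: "k \<ge> 1" for k
    unfolding cycle_def[abs_def]
    by (rule distr_pair_indep[OF prob_space_axioms S_rv path_rv])
       (use k in \<open>auto intro!: indep_setD[OF S_B_indep] waiting_event path_event\<close>)
  then show ?thesis using assms S_ident[of n] B_ident[of n] by simp
qed

lemma cycle_rectangle_event:
  "cycle n -` (A \<times> C) \<inter> space M = (S n -` A \<inter> space M) \<inter> (sample_path B n -` C \<inter> space M)"
  by (auto simp: cycle_def)

text \<open>
  It suffices to consider measurable rectangles. Their probabilities factorise first into a part of the
  waiting times and a part of the processes, and then each part factorises over the two indices.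
\<close>

lemma cycles_indep:
  assumes n: "n \<ge> 1" and k: "k \<ge> 1" and "n \<noteq> k"
  shows "indep_var cycle_space (cycle n) cycle_space (cycle k)"
proof -
  define \<R> :: "(real \<times> (real \<Rightarrow> real)) set set"
    where "\<R> = {A \<times> C |A C. A \<in> sets borel \<and> C \<in> sets path_space}"
  let ?E = "\<lambda>j. {cycle j -` R \<inter> space M |R. R \<in> \<R>}"
  have \<R>_stable: "Int_stable \<R>"
    unfolding \<R>_def by (rule Int_stable_pair_measure_generator)
  have stable: "Int_stable (?E j)" for j
  proof (rule Int_stableI)
    fix a b assume "a \<in> ?E j" "b \<in> ?E j"
    then obtain R R' where R: "R \<in> \<R>" "R' \<in> \<R>"
      and ab: "a = cycle j -` R \<inter> space M" "b = cycle j -` R' \<inter> space M"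
      by blast
    have "a \<inter> b = cycle j -` (R \<inter> R') \<inter> space M" unfolding ab by blast
    with Int_stableD[OF \<R>_stable R] show "a \<inter> b \<in> ?E j" by blast
  qed
  have gen: "sigma_sets (space M) {cycle j -` A \<inter> space M |A. A \<in> sets cycle_space}
      = sigma_sets (space M) (?E j)" if j: "j \<ge> 1" for j
  proof -
    have "{cycle j -` A \<inter> space M |A. A \<in> sets cycle_space} = sigma_sets (space M) (?E j)"
      unfolding sets_pair_measure \<R>_def
      by (rule sigma_sets_vimage_commute)
         (use measurable_space[OF cycle_rv[OF j]] in \<open>auto simp: space_pair_measure\<close>)
    then show ?thesis
      using sigma_sets_sigma_sets_eq[of "?E j" "space M"] by auto
  qed
  have "indep_set (?E n) (?E k)"
  proof (rule indep_setI)
    have "?E j \<subseteq> events" if "j \<ge> 1" for j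
      using measurable_sets[OF cycle_rv[OF that]] by (auto simp: \<R>_def)
    then show "?E n \<subseteq> events" "?E k \<subseteq> events" using n k by auto
  next
    fix a b assume "a \<in> ?E n" "b \<in> ?E k"
    then obtain A C A' C' where AC[measurable]: "A \<in> sets borel" "C \<in> sets path_space"
        "A' \<in> sets borel" "C' \<in> sets path_space"
      and ab: "a = cycle n -` (A \<times> C) \<inter> space M" "b = cycle k -` (A' \<times> C') \<inter> space M"
      unfolding \<R>_def by blast
    define sA where "sA = S n -` A \<inter> space M"
    define sA' where "sA' = S k -` A' \<inter> space M"
    define pC where "pC = sample_path B n -` C \<inter> space M"
    define pC' where "pC' = sample_path B k -` C' \<inter> space M"
    have w: "sA \<in> waiting_events" "sA' \<in> waiting_events"
      unfolding sA_def sA'_def by (intro waiting_event n k AC)+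
    have p: "pC \<in> path_events" "pC' \<in> path_events"
      unfolding pC_def pC'_def by (intro path_event n k AC)+
    have S_split: "prob (sA \<inter> sA') = prob sA * prob sA'"
    proof -
      have "indep_var borel (S n) borel (S k)"
        using indep_var_of_indep_vars[OF S_indep, of n k] n k \<open>n \<noteq> k\<close> by simp
      from indep_varD[OF this, of A A'] show ?thesis by (simp add: sA_def sA'_def Int_def vimage_def conj_ac)
    qed
    have B_split: "prob (pC \<inter> pC') = prob pC * prob pC'"
    proof -
      have "indep_var path_space (sample_path B n) path_space (sample_path B k)"
        using indep_var_of_indep_vars[OF B_indep, of n k] n k \<open>n \<noteq> k\<close> by simp
      from indep_varD[OF this, of C C'] show ?thesis by (simp add: pC_def pC'_def Int_def vimage_def conj_ac)
    qed
    have ab': "a = sA \<inter> pC" "b = sA' \<inter> pC'"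
      unfolding ab sA_def sA'_def pC_def pC'_def by (rule cycle_rectangle_event)+
    have "a \<inter> b = (sA \<inter> sA') \<inter> (pC \<inter> pC')" unfolding ab' by blast
    then have "prob (a \<inter> b) = prob (sA \<inter> sA') * prob (pC \<inter> pC')"
      using indep_setD[OF S_B_indep sets.Int[OF w] sets.Int[OF p]] by simp
    also have "\<dots> = (prob sA * prob pC) * (prob sA' * prob pC')" by (simp add: S_split B_split)
    also have "\<dots> = prob a * prob b"
      unfolding ab' using indep_setD[OF S_B_indep w(1) p(1)] indep_setD[OF S_B_indep w(2) p(2)] by simp
    finally show "prob (a \<inter> b) = prob a * prob b" .
  qed
  then have "indep_set (sigma_sets (space M) (?E n)) (sigma_sets (space M) (?E k))"
    by (rule indep_set_sigma_sets) (rule stable)+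
  then show ?thesis
    using cycle_rv n k by (simp add: indep_var_eq gen)
qed

section \<open>The law of large numbers for integrals over cycles\<close>

definition cycle_integrand :: "(real \<Rightarrow> real) \<Rightarrow> nat \<Rightarrow> real \<Rightarrow> 'a \<Rightarrow> real" where
  "cycle_integrand f n \<tau> \<omega> = (if 0 \<le> \<tau> \<and> \<tau> \<le> S n \<omega> then f (B n \<tau> \<omega>) else 0)"

lemma cycle_integrand_measurable:
  assumes n: "n \<ge> 1" and f[measurable]: "f \<in> borel_measurable borel"
  shows "(\<lambda>(\<tau>, \<omega>). cycle_integrand f n \<tau> \<omega>) \<in> borel_measurable (borel \<Otimes>\<^sub>M M)"
proof -
  \<comment> \<open>\<open>B n\<close> is jointly measurable on nonnegative times only; \<open>max 0\<close> extends it to all times.\<close>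
  have "(\<lambda>x :: real \<times> 'a. (max 0 (fst x), snd x)) \<in> measurable (borel \<Otimes>\<^sub>M M) (restrict_space borel {0..} \<Otimes>\<^sub>M M)"
    by (intro measurable_Pair measurable_restrict_space2) auto
  from measurable_compose[OF this B_measurable[OF n]]
  have [measurable]: "(\<lambda>x. B n (max 0 (fst x)) (snd x)) \<in> borel_measurable (borel \<Otimes>\<^sub>M M)" by simp
  note [measurable] = S_rv[OF n]
  have "(\<lambda>(\<tau>, \<omega>). cycle_integrand f n \<tau> \<omega>) = (\<lambda>x. if 0 \<le> fst x \<and> fst x \<le> S n (snd x) then f (B n (max 0 (fst x)) (snd x)) else 0)"
    by (auto simp: cycle_integrand_def fun_eq_iff)
  also have "\<dots> \<in> borel_measurable (borel \<Otimes>\<^sub>M M)" by measurable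
  finally show ?thesis .
qed

lemma cycle_integral_eq_integrand: "cycle_integral S B f n \<omega> = (\<integral>\<tau>. cycle_integrand f n \<tau> \<omega> \<partial>lborel)"
  unfolding cycle_integral_def set_lebesgue_integral_def
  by (intro Bochner_Integration.integral_cong refl) (auto simp: cycle_integrand_def indicator_def)

lemma cycle_abs_integral_eq_integrand:
  "cycle_abs_integral S B f n \<omega> = (\<integral>\<^sup>+\<tau>. ennreal \<bar>cycle_integrand f n \<tau> \<omega>\<bar> \<partial>lborel)"
  unfolding cycle_abs_integral_def
  by (intro nn_integral_cong) (auto simp: cycle_integrand_def indicator_def)

lemma coordinate_measurable:
  assumes "u \<ge> 0" and [measurable]: "f \<in> borel_measurable borel"
  shows "(\<lambda>x. f (snd x u)) \<in> borel_measurable cycle_space"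
proof -
  have "(\<lambda>x. snd x u) \<in> borel_measurable cycle_space"
    using assms(1) by (intro measurable_compose[OF measurable_snd measurable_component_singleton]) auto
  then show ?thesis by measurable
qed

text \<open>
  The value at time \<open>u\<close> of the integrand of a cycle, as a function of the waiting time and the path
  instead of the sample point. For fixed \<open>u\<close> it is measurable for the cylinder \<open>\<sigma>\<close>-algebra; evaluation
  at negative \<open>u\<close>, which is not a coordinate of the path space, is avoided.
\<close>

definition path_integrand :: "(real \<Rightarrow> real) \<Rightarrow> real \<Rightarrow> real \<times> (real \<Rightarrow> real) \<Rightarrow> real" where
  "path_integrand f u x = (if 0 \<le> u \<and> u \<le> fst x then f (snd x u) else 0)"

lemma path_integrand_measurable:
  assumes "f \<in> borel_measurable borel"
  shows "path_integrand f u \<in> borel_measurable cycle_space"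
proof (cases "u \<ge> 0")
  case True
  note [measurable] = coordinate_measurable[OF True assms]
  show ?thesis unfolding path_integrand_def[abs_def] by measurable
qed (simp add: path_integrand_def[abs_def])

lemma cycle_integrand_eq_path_integrand: "cycle_integrand f n u \<omega> = path_integrand f u (cycle n \<omega>)"
  by (simp add: cycle_integrand_def path_integrand_def cycle_def sample_path_def)

text \<open>
  Tonelli's theorem reduces the claim to a single time, where the integrand depends only on the law of
  the cycle. Finiteness thereby passes from the first cycle to all of them, as the quadrature of the
  time integrals requires.
\<close>

lemma nn_integral_cycle_abs_integral:
  assumes n: "n \<ge> 1" and f: "f \<in> borel_measurable borel"
  shows "(\<integral>\<^sup>+\<omega>. cycle_abs_integral S B f n \<omega> \<partial>M) = (\<integral>\<^sup>+\<omega>. cycle_abs_integral S B f 1 \<omega> \<partial>M)"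
proof -
  interpret L: pair_sigma_finite lborel M ..
  have "(\<integral>\<^sup>+\<omega>. cycle_abs_integral S B f k \<omega> \<partial>M)
      = (\<integral>\<^sup>+\<tau>. (\<integral>\<^sup>+x. ennreal \<bar>path_integrand f \<tau> x\<bar> \<partial>distr M cycle_space (cycle k)) \<partial>lborel)" if k: "k \<ge> 1" for k
  proof -
    note [measurable] = cycle_integrand_measurable[OF k f] path_integrand_measurable[OF f] cycle_rv[OF k]
    have "(\<integral>\<^sup>+\<omega>. cycle_abs_integral S B f k \<omega> \<partial>M) = (\<integral>\<^sup>+\<omega>. \<integral>\<^sup>+\<tau>. ennreal \<bar>cycle_integrand f k \<tau> \<omega>\<bar> \<partial>lborel \<partial>M)"
      by (simp add: cycle_abs_integral_eq_integrand)
    also have "\<dots> = (\<integral>\<^sup>+\<tau>. \<integral>\<^sup>+\<omega>. ennreal \<bar>cycle_integrand f k \<tau> \<omega>\<bar> \<partial>M \<partial>lborel)"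
      by (rule L.Fubini') measurable
    also have "\<dots> = (\<integral>\<^sup>+\<tau>. (\<integral>\<^sup>+x. ennreal \<bar>path_integrand f \<tau> x\<bar> \<partial>distr M cycle_space (cycle k)) \<partial>lborel)"
      by (intro nn_integral_cong, subst nn_integral_distr) (auto simp: cycle_integrand_eq_path_integrand)
    finally show ?thesis .
  qed
  from this[OF n] this[of 1] show ?thesis by (simp add: cycle_law[OF n])
qed

lemma cycle_integrand_integrable_AE:
  assumes n: "n \<ge> 1" and f: "f \<in> borel_measurable borel"
    and fin: "(\<integral>\<^sup>+\<omega>. cycle_abs_integral S B f 1 \<omega> \<partial>M) < \<infinity>"
  shows "AE \<omega> in M. integrable lborel (\<lambda>\<tau>. cycle_integrand f n \<tau> \<omega>)"
proof -
  note [measurable] = cycle_integrand_measurable[OF n f]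
  have "(\<integral>\<^sup>+\<omega>. cycle_abs_integral S B f n \<omega> \<partial>M) \<noteq> \<infinity>"
    using fin nn_integral_cycle_abs_integral[OF n f] by simp
  then have "AE \<omega> in M. cycle_abs_integral S B f n \<omega> \<noteq> \<infinity>"
    by (intro nn_integral_PInf_AE) (simp_all add: cycle_abs_integral_eq_integrand)
  then show ?thesis
    using AE_space
  proof eventually_elim
    case (elim \<omega>)
    then show ?case by (intro integrableI_bounded) (auto simp: cycle_abs_integral_eq_integrand top.not_eq_extremum)
  qed
qed

lemma cycle_integral_integrable:
  assumes f: "f \<in> borel_measurable borel"
    and fin: "(\<integral>\<^sup>+\<omega>. cycle_abs_integral S B f 1 \<omega> \<partial>M) < \<infinity>"
  shows "integrable M (cycle_integral S B f 1)"
proof (rule integrableI_bounded)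
  note [measurable] = cycle_integrand_measurable[OF order_refl f]
  show "cycle_integral S B f 1 \<in> borel_measurable M"
    unfolding cycle_integral_eq_integrand[abs_def] by measurable
  have "(\<integral>\<^sup>+\<omega>. ennreal (norm (cycle_integral S B f 1 \<omega>)) \<partial>M)
      \<le> (\<integral>\<^sup>+\<omega>. cycle_abs_integral S B f 1 \<omega> \<partial>M)"
    unfolding cycle_integral_eq_integrand cycle_abs_integral_eq_integrand
    using cycle_integrand_integrable_AE[OF order_refl f fin]
    by (intro nn_integral_mono_AE) (auto elim!: eventually_mono dest: integral_norm_bound_ennreal)
  also note fin
  finally show "(\<integral>\<^sup>+\<omega>. ennreal (norm (cycle_integral S B f 1 \<omega>)) \<partial>M) < \<infinity>" .
qed

text \<open>
  The functional is the limit of the quadrature sums over nodes that are common to all cycles. It does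
  not depend on the index of the cycle, and it involves only countably many coordinates of the path,
  which makes it measurable; it may differ from the time integral on a null event.
\<close>

lemma cycle_integral_functional:
  assumes f: "f \<in> borel_measurable borel"
    and fin: "(\<integral>\<^sup>+\<omega>. cycle_abs_integral S B f 1 \<omega> \<partial>M) < \<infinity>"
  obtains \<Phi> where "\<Phi> \<in> borel_measurable cycle_space"
    "\<And>n. n \<ge> 1 \<Longrightarrow> AE \<omega> in M. cycle_integral S B f n \<omega> = \<Phi> (cycle n \<omega>)"
proof -
  obtain u :: "nat \<Rightarrow> real" where u: "\<And>n. AE \<omega> in M.
     (\<lambda>N. (\<Sum>i<N. exp (u i) * cycle_integrand f (Suc n) (u i) \<omega>) / real N) \<longlonglongrightarrow> (\<integral>t. cycle_integrand f (Suc n) t \<omega> \<partial>lborel)"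
  proof (rule common_quadrature_nodes[of "\<lambda>n. cycle_integrand f (Suc n)"])
    show "(\<lambda>(t, \<omega>). cycle_integrand f (Suc n) t \<omega>) \<in> borel_measurable (borel \<Otimes>\<^sub>M M)" for n
      by (rule cycle_integrand_measurable[OF _ f]) simp
    show "AE \<omega> in M. integrable lborel (\<lambda>t. cycle_integrand f (Suc n) t \<omega>)" for n
      by (rule cycle_integrand_integrable_AE[OF _ f fin]) simp
  qed (auto simp: cycle_integrand_def)
  define \<Phi> where "\<Phi> x = lim (\<lambda>N. (\<Sum>i<N. exp (u i) * path_integrand f (u i) x) / real N)" for x
  note [measurable] = path_integrand_measurable[OF f]
  have "\<Phi> \<in> borel_measurable cycle_space"
    unfolding \<Phi>_def[abs_def] by measurable
  moreover have "AE \<omega> in M. cycle_integral S B f n \<omega> = \<Phi> (cycle n \<omega>)" if "n \<ge> 1" for n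
  proof -
    obtain j where j: "n = Suc j" using \<open>n \<ge> 1\<close> by (cases n) auto
    from u[of j] show ?thesis
      by eventually_elim (simp add: j \<Phi>_def cycle_integrand_eq_path_integrand cycle_integral_eq_integrand limI)
  qed
  ultimately show thesis by (rule that)
qed

lemma cycle_integral_law_of_large_numbers:
  assumes f: "f \<in> borel_measurable borel"
    and fin: "(\<integral>\<^sup>+\<omega>. cycle_abs_integral S B f 1 \<omega> \<partial>M) < \<infinity>"
  shows "AE \<omega> in M. (\<lambda>n. (\<Sum>i=1..n. cycle_integral S B f i \<omega>) / real n)
    \<longlonglongrightarrow> expectation (cycle_integral S B f 1)"
proof -
  obtain \<Phi> where \<Phi>[measurable]: "\<Phi> \<in> borel_measurable cycle_space"
    and eq: "\<And>n. n \<ge> 1 \<Longrightarrow> AE \<omega> in M. cycle_integral S B f n \<omega> = \<Phi> (cycle n \<omega>)"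
    using cycle_integral_functional[OF f fin] by blast
  have [measurable]: "cycle (Suc n) \<in> measurable M cycle_space" for n by (rule cycle_rv) simp
  have int: "integrable M (cycle_integral S B f 1)" by (rule cycle_integral_integrable[OF f fin])
  have eq1: "AE \<omega> in M. cycle_integral S B f 1 \<omega> = \<Phi> (cycle (Suc 0) \<omega>)"
    using eq[of 1] by simp
  have "AE \<omega> in M. (\<lambda>n. (\<Sum>i<n. \<Phi> (cycle (Suc i) \<omega>)) / real n) \<longlonglongrightarrow> expectation (\<lambda>\<omega>. \<Phi> (cycle (Suc 0) \<omega>))"
  proof (rule strong_law_pairwise_independent)
    show "indep_var borel (\<lambda>\<omega>. \<Phi> (cycle (Suc i) \<omega>)) borel (\<lambda>\<omega>. \<Phi> (cycle (Suc j) \<omega>))" if "i \<noteq> j" for i j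
      using indep_var_compose[OF cycles_indep[of "Suc i" "Suc j"] \<Phi> \<Phi>] that by (simp add: o_def)
    show "distr M borel (\<lambda>\<omega>. \<Phi> (cycle (Suc i) \<omega>)) = distr M borel (\<lambda>\<omega>. \<Phi> (cycle (Suc 0) \<omega>))" for i
      using distr_distr[OF \<Phi>, of "cycle (Suc i)" M] distr_distr[OF \<Phi>, of "cycle (Suc 0)" M]
        cycle_law[of "Suc i"] by (simp add: o_def)
    show "integrable M (\<lambda>\<omega>. \<Phi> (cycle (Suc 0) \<omega>))"
      by (rule integrable_cong_AE_imp[OF int]) (use eq1 in \<open>auto elim: eventually_mono\<close>)
  qed
  moreover have "expectation (\<lambda>\<omega>. \<Phi> (cycle (Suc 0) \<omega>)) = expectation (cycle_integral S B f 1)"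
    by (rule integral_cong_AE) (use int eq1 in \<open>auto elim: eventually_mono\<close>)
  moreover have "AE \<omega> in M. \<forall>i. cycle_integral S B f (Suc i) \<omega> = \<Phi> (cycle (Suc i) \<omega>)"
    unfolding AE_all_countable using eq by simp
  ultimately show ?thesis
  proof (elim AE_mp, intro AE_I2 impI, goal_cases)
    case (1 \<omega>)
    have "(\<Sum>i=1..n. cycle_integral S B f i \<omega>) = (\<Sum>i<n. \<Phi> (cycle (Suc i) \<omega>))" for n
      using 1 by (simp add: sum.atLeast1_atMost_eq)
    then show ?case using 1 by simp
  qed
qed

end

section \<open>Decomposition of a sample path into cycles\<close>

lemma set_integral_shift:
  fixes g :: "real \<Rightarrow> real"
  shows "set_integrable lborel {a..<a + u} (\<lambda>\<tau>. g (\<tau> - a)) \<longleftrightarrow> set_integrable lborel {0..<u} g"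
    and "(LBINT \<tau>:{a..<a + u}. g (\<tau> - a)) = (LBINT \<tau>:{0..<u}. g \<tau>)"
proof -
  have ind: "indicator {a..<a + u} (a + 1 * x) = (indicator {0..<u} x :: real)" for x
    by (auto simp: indicator_def)
  show "set_integrable lborel {a..<a + u} (\<lambda>\<tau>. g (\<tau> - a)) \<longleftrightarrow> set_integrable lborel {0..<u} g"
    unfolding set_integrable_def
    by (subst lborel_integrable_real_affine_iff[of 1 _ a, symmetric]) (simp_all only: ind, simp_all)
  show "(LBINT \<tau>:{a..<a + u}. g (\<tau> - a)) = (LBINT \<tau>:{0..<u}. g \<tau>)"
    unfolding set_lebesgue_integral_def
    by (subst lborel_integral_real_affine[of 1 _ a]) (simp_all only: ind, simp_all)
qed

lemma set_integral_closed_half_open: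
  fixes g :: "real \<Rightarrow> real"
  shows "set_integrable lborel {a..<b} g \<longleftrightarrow> set_integrable lborel {a..b} g"
    and "set_integrable lborel {a..<b} g \<Longrightarrow> (LBINT \<tau>:{a..b}. g \<tau>) = (LBINT \<tau>:{a..<b}. g \<tau>)"
proof -
  have null: "emeasure lborel ({a..b} \<inter> {b}) = 0"
    by (rule emeasure_lborel_countable) simp
  have pt: "set_integrable lborel ({a..b} \<inter> {b}) g"
  proof -
    have "set_integrable lborel ({a..b} \<inter> {b}) (\<lambda>_. g b)"
      unfolding set_integrable_def by (rule integrable_real_indicator[THEN integrable_scaleR_left]) (simp_all add: null)
    then show ?thesis by (rule set_integrable_cong[THEN iffD1, rotated -1]) auto
  qed
  have un: "{a..b} = {a..<b} \<union> ({a..b} \<inter> {b})" by auto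
  show iff: "set_integrable lborel {a..<b} g \<longleftrightarrow> set_integrable lborel {a..b} g"
  proof
    assume "set_integrable lborel {a..<b} g"
    then show "set_integrable lborel {a..b} g" by (subst un, intro set_integrable_Un pt) auto
  qed (auto elim: set_integrable_subset)
  assume "set_integrable lborel {a..<b} g"
  then have "(LBINT \<tau>:{a..b}. g \<tau>) = (LBINT \<tau>:{a..<b}. g \<tau>) + (LBINT \<tau>:{a..b} \<inter> {b}. g \<tau>)"
    by (subst un, intro set_integral_Un pt) auto
  moreover have "(LBINT \<tau>:{a..b} \<inter> {b}. g \<tau>) = (LBINT \<tau>:{a..b} \<inter> {b}. g b)"
    by (rule set_lebesgue_integral_cong) auto
  moreover have "\<dots> = 0" by (simp add: set_lebesgue_integral_def measure_def null)
  ultimately show "(LBINT \<tau>:{a..b}. g \<tau>) = (LBINT \<tau>:{a..<b}. g \<tau>)" by simp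
qed

lemma next_term_over_index_tendsto_zero:
  fixes x :: "nat \<Rightarrow> real"
  assumes "(\<lambda>n. (\<Sum>i=1..n. x i) / real n) \<longlonglongrightarrow> y"
  shows "(\<lambda>n. x (Suc n) / real n) \<longlonglongrightarrow> 0"
proof -
  have "(\<lambda>n. (\<Sum>i=1..Suc n. x i) / real (Suc n) * (real (Suc n) / real n) - (\<Sum>i=1..n. x i) / real n)
      \<longlonglongrightarrow> y * 1 - y"
    by (intro tendsto_diff tendsto_mult LIMSEQ_Suc[OF assms] assms LIMSEQ_Suc_n_over_n)
  moreover have "(\<Sum>i=1..Suc n. x i) / real (Suc n) * (real (Suc n) / real n) - (\<Sum>i=1..n. x i) / real n
      = x (Suc n) / real n" for n
    by (simp add: diff_divide_distrib[symmetric] del: of_nat_Suc)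
  ultimately show ?thesis by simp
qed

text \<open>
  A single sample point along which the three averages converge; the arguments in this locale are
  deterministic. The integrals of \<open>\<bar>f\<bar>\<close> enter because the fragment of a cycle that is unfinished at
  time \<open>t\<close> is controlled by the \<open>\<bar>f\<bar>\<close>-integral over the whole cycle, but not by its \<open>f\<close>-integral.
\<close>

locale reset_path =
  fixes S :: "nat \<Rightarrow> 'a \<Rightarrow> real" and B :: "nat \<Rightarrow> real \<Rightarrow> 'a \<Rightarrow> real" and f :: "real \<Rightarrow> real"
    and \<omega> :: 'a and m x y :: real
  assumes S_nonneg: "\<And>n. n \<ge> 1 \<Longrightarrow> S n \<omega> \<ge> 0"
    and integrable: "\<And>n. n \<ge> 1 \<Longrightarrow> set_integrable lborel {0..S n \<omega>} (\<lambda>\<tau>. f (B n \<tau> \<omega>))"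
    and m_pos: "m > 0"
    and S_mean: "(\<lambda>n. reset_time S n \<omega> / real n) \<longlonglongrightarrow> m"
    and X_mean: "(\<lambda>n. (\<Sum>i=1..n. cycle_integral S B f i \<omega>) / real n) \<longlonglongrightarrow> x"
    and abs_mean: "(\<lambda>n. (\<Sum>i=1..n. cycle_integral S B (\<lambda>z. \<bar>f z\<bar>) i \<omega>) / real n) \<longlonglongrightarrow> y"
begin

abbreviation T :: "nat \<Rightarrow> real" where "T n \<equiv> reset_time S n \<omega>"
abbreviation N :: "real \<Rightarrow> nat" where "N t \<equiv> reset_count S t \<omega>"
abbreviation fZ :: "real \<Rightarrow> real" where "fZ t \<equiv> f (reset_process S B t \<omega>)"
abbreviation fB :: "nat \<Rightarrow> real \<Rightarrow> real" where "fB n t \<equiv> f (B n t \<omega>)"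

lemma T_0: "T 0 = 0" by (simp add: reset_time_def)

lemma T_Suc: "T (Suc n) = T n + S (Suc n) \<omega>" by (simp add: reset_time_def)

lemma mono_T: "mono T"
  by (rule incseq_SucI) (simp add: T_Suc S_nonneg)

lemma T_nonneg: "T n \<ge> 0"
  using monoD[OF mono_T, of 0 n] by (simp add: T_0)

lemma T_unbounded: "filterlim T at_top sequentially"
proof -
  have "filterlim (\<lambda>n. T n / real n * real n) at_top sequentially"
    by (rule filterlim_tendsto_pos_mult_at_top[OF S_mean m_pos filterlim_real_sequentially])
  moreover have "T n / real n * real n = T n" for n by (cases n) (auto simp: T_0)
  ultimately show ?thesis by simp
qed

lemma reset_count_eq:
  assumes "T n \<le> t" "t < T (Suc n)"
  shows "N t = n"
proof -
  have "{k. T k \<le> t} = {..n}"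
  proof safe
    fix k assume "T k \<le> t"
    then have "\<not> T (Suc n) \<le> T k" using assms by linarith
    then show "k \<le> n" using monoD[OF mono_T, of "Suc n" k] by linarith
  next
    fix k assume "k \<le> n"
    then show "T k \<le> t" using monoD[OF mono_T, of k n] assms by linarith
  qed
  then show ?thesis by (simp add: reset_count_def)
qed

lemma reset_count_bracket:
  assumes "t \<ge> 0"
  shows "T (N t) \<le> t" "t < T (Suc (N t))"
proof -
  obtain k where k: "t < T k"
    using T_unbounded by (auto simp: filterlim_at_top_dense eventually_sequentially)
  define n where "n = (LEAST k. t < T (Suc k))"
  have "t < T (Suc k)" using k monoD[OF mono_T, of k "Suc k"] by simp
  then have n: "t < T (Suc n)" unfolding n_def by (rule LeastI)
  have "T n \<le> t"
  proof (cases n)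
    case 0
    then show ?thesis using assms by (simp add: T_0)
  next
    case (Suc j)
    then show ?thesis using not_less_Least[of j "\<lambda>k. t < T (Suc k)"] by (simp add: n_def not_less)
  qed
  with n reset_count_eq[of n t] show "T (N t) \<le> t" "t < T (Suc (N t))" by auto
qed

text \<open>
  The interval is half-open because the next cycle is in force from its starting time
  \<open>T (Suc n)\<close> on.
\<close>

lemma cycle_fragment:
  assumes "T n \<le> t" "t \<le> T (Suc n)"
  shows "set_integrable lborel {T n..<t} fZ"
    and "(LBINT \<tau>:{T n..<t}. fZ \<tau>) = (LBINT \<tau>:{0..t - T n}. fB (Suc n) \<tau>)"
proof -
  have *: "fZ \<tau> = fB (Suc n) (\<tau> - T n)" if "\<tau> \<in> {T n..<t}" for \<tau>
    using that assms reset_count_eq[of n \<tau>] by (simp add: reset_process_def)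
  have int: "set_integrable lborel {0..<t - T n} (fB (Suc n))"
    by (rule set_integrable_subset[OF integrable[of "Suc n"]]) (use assms in \<open>auto simp: T_Suc\<close>)
  have t: "t = T n + (t - T n)" by simp
  have "set_integrable lborel {T n..<t} (\<lambda>\<tau>. fB (Suc n) (\<tau> - T n))"
    by (subst t, subst set_integral_shift) (rule int)
  then show "set_integrable lborel {T n..<t} fZ"
    by (rule set_integrable_cong[THEN iffD1, rotated -1]) (auto simp: *)
  have "(LBINT \<tau>:{T n..<t}. fZ \<tau>) = (LBINT \<tau>:{T n..<t}. fB (Suc n) (\<tau> - T n))"
    by (rule set_lebesgue_integral_cong) (auto simp: *)
  also have "\<dots> = (LBINT \<tau>:{0..<t - T n}. fB (Suc n) \<tau>)"
    by (subst t, subst set_integral_shift) (rule refl)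
  also have "\<dots> = (LBINT \<tau>:{0..t - T n}. fB (Suc n) \<tau>)"
    using set_integral_closed_half_open(2)[OF int] by simp
  finally show "(LBINT \<tau>:{T n..<t}. fZ \<tau>) = (LBINT \<tau>:{0..t - T n}. fB (Suc n) \<tau>)" .
qed

lemma complete_cycles:
  "set_integrable lborel {0..<T n} fZ \<and>
   (LBINT \<tau>:{0..<T n}. fZ \<tau>) = (\<Sum>i=1..n. cycle_integral S B f i \<omega>)"
proof (induction n)
  case 0
  then show ?case by (simp add: T_0 set_integrable_def set_lebesgue_integral_def)
next
  case (Suc n)
  have le: "T n \<le> T (Suc n)" using monoD[OF mono_T, of n "Suc n"] by simp
  have un: "{0..<T (Suc n)} = {0..<T n} \<union> {T n..<T (Suc n)}"
    using le T_nonneg[of n] by auto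
  note frag = cycle_fragment[OF le order_refl]
  have "set_integrable lborel {0..<T (Suc n)} fZ"
    unfolding un using Suc frag(1) by (intro set_integrable_Un) auto
  moreover have "(LBINT \<tau>:{0..<T (Suc n)}. fZ \<tau>)
      = (LBINT \<tau>:{0..<T n}. fZ \<tau>) + (LBINT \<tau>:{T n..<T (Suc n)}. fZ \<tau>)"
    unfolding un using Suc frag(1) by (intro set_integral_Un) auto
  moreover have "(LBINT \<tau>:{T n..<T (Suc n)}. fZ \<tau>) = cycle_integral S B f (Suc n) \<omega>"
    unfolding frag(2) by (simp add: cycle_integral_def T_Suc)
  ultimately show ?case using Suc by simp
qed

lemma additive_functional_deviation:
  assumes "t \<ge> 0"
  shows "\<bar>additive_functional S B f t \<omega> - (\<Sum>i=1..N t. cycle_integral S B f i \<omega>)\<bar>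
    \<le> cycle_integral S B (\<lambda>z. \<bar>f z\<bar>) (Suc (N t)) \<omega>"
proof -
  let ?n = "N t"
  note br = reset_count_bracket[OF assms]
  note frag = cycle_fragment[OF br(1) less_imp_le[OF br(2)]]
  have un: "{0..<t} = {0..<T ?n} \<union> {T ?n..<t}" using br(1) T_nonneg[of ?n] by auto
  have int: "set_integrable lborel {0..<t} fZ"
    unfolding un using complete_cycles frag(1) by (intro set_integrable_Un) auto
  have "additive_functional S B f t \<omega> = (LBINT \<tau>:{0..<t}. fZ \<tau>)"
    unfolding additive_functional_def by (rule set_integral_closed_half_open(2)[OF int])
  also have "\<dots> = (LBINT \<tau>:{0..<T ?n}. fZ \<tau>) + (LBINT \<tau>:{T ?n..<t}. fZ \<tau>)"
    unfolding un using complete_cycles frag(1) by (intro set_integral_Un) auto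
  finally have "\<bar>additive_functional S B f t \<omega> - (\<Sum>i=1..?n. cycle_integral S B f i \<omega>)\<bar>
      = \<bar>LBINT \<tau>:{0..t - T ?n}. fB (Suc ?n) \<tau>\<bar>"
    using complete_cycles[of ?n] frag(2) by simp
  also have "\<dots> \<le> (LBINT \<tau>:{0..t - T ?n}. \<bar>fB (Suc ?n) \<tau>\<bar>)"
    unfolding set_lebesgue_integral_def
    by (rule order_trans[OF integral_abs_bound]) (simp add: abs_mult)
  also have "\<dots> \<le> (LBINT \<tau>:{0..S (Suc ?n) \<omega>}. \<bar>fB (Suc ?n) \<tau>\<bar>)"
  proof -
    have whole: "set_integrable lborel {0..S (Suc ?n) \<omega>} (\<lambda>\<tau>. \<bar>fB (Suc ?n) \<tau>\<bar>)"
      using integrable[of "Suc ?n"] by (intro set_integrable_abs) auto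
    moreover have "set_integrable lborel {0..t - T ?n} (\<lambda>\<tau>. \<bar>fB (Suc ?n) \<tau>\<bar>)"
      by (rule set_integrable_subset[OF whole]) (use br in \<open>auto simp: T_Suc\<close>)
    ultimately show ?thesis
      unfolding set_lebesgue_integral_def set_integrable_def
      by (intro integral_mono) (use br in \<open>auto simp: T_Suc indicator_def\<close>)
  qed
  finally show ?thesis by (simp add: cycle_integral_def)
qed

lemma reset_count_tendsto: "filterlim N at_top at_top"
  unfolding filterlim_at_top
proof
  fix n
  have "n \<le> N t" if "t \<ge> T n" for t
  proof (rule ccontr)
    assume "\<not> n \<le> N t"
    then have "T (Suc (N t)) \<le> T n" by (intro monoD[OF mono_T]) simp
    moreover have "t \<ge> 0" using that T_nonneg[of n] by linarith
    ultimately show False using reset_count_bracket(2)[of t] that by linarith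
  qed
  then show "\<forall>\<^sub>F t in at_top. n \<le> N t"
    by (rule eventually_mono[OF eventually_ge_at_top])
qed

lemma time_per_reset_tendsto: "((\<lambda>t. t / real (N t)) \<longlongrightarrow> m) at_top"
proof (rule tendsto_sandwich)
  show "((\<lambda>t. T (N t) / real (N t)) \<longlongrightarrow> m) at_top"
    by (rule filterlim_compose[OF S_mean reset_count_tendsto])
  have "(\<lambda>n. T (Suc n) / real (Suc n) * (real (Suc n) / real n)) \<longlonglongrightarrow> m * 1"
    by (intro tendsto_mult LIMSEQ_Suc[OF S_mean] LIMSEQ_Suc_n_over_n)
  then have "(\<lambda>n. T (Suc n) / real n) \<longlonglongrightarrow> m" by (simp del: of_nat_Suc)
  from filterlim_compose[OF this reset_count_tendsto]
  show "((\<lambda>t. T (Suc (N t)) / real (N t)) \<longlongrightarrow> m) at_top" .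
  show "\<forall>\<^sub>F t in at_top. T (N t) / real (N t) \<le> t / real (N t)"
    using eventually_ge_at_top[of 0]
    by eventually_elim (auto intro!: divide_right_mono reset_count_bracket)
  show "\<forall>\<^sub>F t in at_top. t / real (N t) \<le> T (Suc (N t)) / real (N t)"
    using eventually_ge_at_top[of 0]
    by eventually_elim (auto intro!: divide_right_mono less_imp_le[OF reset_count_bracket(2)])
qed

lemma additive_functional_mean_tendsto:
  "((\<lambda>t. additive_functional S B f t \<omega> / t) \<longlongrightarrow> x / m) at_top"
proof -
  let ?F = "\<lambda>t. additive_functional S B f t \<omega>"
  let ?G = "\<lambda>n. \<Sum>i=1..n. cycle_integral S B f i \<omega>"
  have "((\<lambda>t. (?F t - ?G (N t)) / real (N t)) \<longlongrightarrow> 0) at_top"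
  proof (rule Lim_null_comparison)
    show "((\<lambda>t. cycle_integral S B (\<lambda>z. \<bar>f z\<bar>) (Suc (N t)) \<omega> / real (N t)) \<longlongrightarrow> 0) at_top"
      by (rule filterlim_compose[OF next_term_over_index_tendsto_zero[OF abs_mean] reset_count_tendsto])
    show "\<forall>\<^sub>F t in at_top. norm ((?F t - ?G (N t)) / real (N t))
        \<le> cycle_integral S B (\<lambda>z. \<bar>f z\<bar>) (Suc (N t)) \<omega> / real (N t)"
      using eventually_ge_at_top[of 0]
      by eventually_elim (use additive_functional_deviation in \<open>simp add: divide_right_mono\<close>)
  qed
  from tendsto_add[OF this filterlim_compose[OF X_mean reset_count_tendsto]]
  have "((\<lambda>t. ?F t / real (N t)) \<longlongrightarrow> x) at_top"
    by (simp add: diff_divide_distrib)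
  then have "((\<lambda>t. (?F t / real (N t)) / (t / real (N t))) \<longlongrightarrow> x / m) at_top"
    by (intro tendsto_divide time_per_reset_tendsto) (use m_pos in auto)
  moreover have "\<forall>\<^sub>F t in at_top. N t \<ge> 1"
    using reset_count_tendsto by (simp add: filterlim_at_top)
  then have "\<forall>\<^sub>F t in at_top. (?F t / real (N t)) / (t / real (N t)) = ?F t / t"
    by eventually_elim simp
  ultimately show ?thesis by (rule Lim_transform_eventually)
qed

end

section \<open>The limit of the additive functional\<close>

context resetting begin

lemma cycle_integral_one:
  assumes "n \<ge> 1" "\<omega> \<in> space M"
  shows "cycle_integral S B (\<lambda>_. 1) n \<omega> = S n \<omega>"
  using S_nonneg[OF assms] by (simp add: cycle_integral_def set_lebesgue_integral_def)

lemma cycle_abs_integral_one: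
  assumes "n \<ge> 1" "\<omega> \<in> space M"
  shows "cycle_abs_integral S B (\<lambda>_. 1) n \<omega> = ennreal (S n \<omega>)"
  using S_nonneg[OF assms] by (simp add: cycle_abs_integral_def)

lemma mean_waiting_time_pos:
  assumes "(\<integral>\<^sup>+\<omega>. ennreal (S 1 \<omega>) \<partial>M) < \<infinity>"
  shows "expectation (S 1) > 0"
proof -
  have nonneg: "AE \<omega> in M. 0 \<le> S 1 \<omega>" by (rule AE_I2) (simp add: S_nonneg)
  have int: "integrable M (S 1)"
    by (rule integrableI_nonneg) (use S_rv[OF order_refl] assms nonneg in auto)
  have "expectation (S 1) \<noteq> 0"
  proof
    assume "expectation (S 1) = 0"
    then have "AE \<omega> in M. S 1 \<omega> = 0"
      using integral_nonneg_eq_0_iff_AE[OF int nonneg] by simp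
    moreover have "{\<omega> \<in> space M. S 1 \<omega> = 0} \<in> events"
      using int by measurable
    ultimately have "prob {\<omega> \<in> space M. S 1 \<omega> = 0} = 1"
      by (simp only: prob_Collect_eq_1)
    with S_nontrivial show False by simp
  qed
  moreover have "expectation (S 1) \<ge> 0" by (rule integral_nonneg_AE[OF nonneg])
  ultimately show ?thesis by linarith
qed

end

theorem theorem3p1:
  fixes M :: "'a measure"
    and S :: "nat \<Rightarrow> 'a \<Rightarrow> real"
    and B :: "nat \<Rightarrow> real \<Rightarrow> 'a \<Rightarrow> real"
    and f :: "real \<Rightarrow> real"
  assumes "resetting M S B"
    and "f \<in> borel_measurable borel"
    and "(\<integral>\<^sup>+\<omega>. ennreal (S 1 \<omega>) \<partial>M) < \<infinity>"
    and "(\<integral>\<^sup>+\<omega>. cycle_abs_integral S B f 1 \<omega> \<partial>M) < \<infinity>"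
  shows "AE \<omega> in M.
    ((\<lambda>t. additive_functional S B f t \<omega> / t) \<longlongrightarrow>
      (\<integral>\<omega>'. cycle_integral S B f 1 \<omega>' \<partial>M) / (\<integral>\<omega>'. S 1 \<omega>' \<partial>M)) at_top"
proof -
  interpret resetting M S B by (rule assms(1))
  note f[measurable] = assms(2)
  have X: "AE \<omega> in M. (\<lambda>n. (\<Sum>i=1..n. cycle_integral S B f i \<omega>) / real n)
      \<longlonglongrightarrow> expectation (cycle_integral S B f 1)"
    by (rule cycle_integral_law_of_large_numbers[OF f assms(4)])
  have "cycle_abs_integral S B (\<lambda>z. \<bar>f z\<bar>) 1 = cycle_abs_integral S B f 1"
    by (simp add: cycle_abs_integral_def fun_eq_iff)
  then have absX: "AE \<omega> in M. (\<lambda>n. (\<Sum>i=1..n. cycle_integral S B (\<lambda>z. \<bar>f z\<bar>) i \<omega>) / real n)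
      \<longlonglongrightarrow> expectation (cycle_integral S B (\<lambda>z. \<bar>f z\<bar>) 1)"
    using assms(4) by (intro cycle_integral_law_of_large_numbers) simp_all
  have "(\<integral>\<^sup>+\<omega>. cycle_abs_integral S B (\<lambda>_. 1) 1 \<omega> \<partial>M) = (\<integral>\<^sup>+\<omega>. ennreal (S 1 \<omega>) \<partial>M)"
    by (intro nn_integral_cong cycle_abs_integral_one) auto
  then have one: "AE \<omega> in M. (\<lambda>n. (\<Sum>i=1..n. cycle_integral S B (\<lambda>_. 1) i \<omega>) / real n)
      \<longlonglongrightarrow> expectation (cycle_integral S B (\<lambda>_. 1) 1)"
    using assms(3) by (intro cycle_integral_law_of_large_numbers) simp_all
  have mean_one: "expectation (cycle_integral S B (\<lambda>_. 1) 1) = expectation (S 1)"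
    by (intro Bochner_Integration.integral_cong refl cycle_integral_one) auto
  have "AE \<omega> in M. integrable lborel (\<lambda>\<tau>. cycle_integrand f (Suc n) \<tau> \<omega>)" for n
    by (rule cycle_integrand_integrable_AE[OF _ f assms(4)]) simp
  then have "AE \<omega> in M. \<forall>n. integrable lborel (\<lambda>\<tau>. cycle_integrand f (Suc n) \<tau> \<omega>)"
    by (simp add: AE_all_countable)
  with X absX one AE_space show ?thesis
  proof eventually_elim
    case (elim \<omega>)
    have "reset_path S B f \<omega> (expectation (S 1)) (expectation (cycle_integral S B f 1))
        (expectation (cycle_integral S B (\<lambda>z. \<bar>f z\<bar>) 1))"
    proof
      show "S n \<omega> \<ge> 0" if "n \<ge> 1" for n using S_nonneg[OF that] elim by simp
      show "set_integrable lborel {0..S n \<omega>} (\<lambda>\<tau>. f (B n \<tau> \<omega>))" if n: "n \<ge> 1" for n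
      proof -
        obtain j where "n = Suc j" using n by (cases n) auto
        then have "integrable lborel (\<lambda>\<tau>. cycle_integrand f n \<tau> \<omega>)" using elim by simp
        moreover have "cycle_integrand f n \<tau> \<omega> = indicator {0..S n \<omega>} \<tau> *\<^sub>R f (B n \<tau> \<omega>)" for \<tau>
          by (simp add: cycle_integrand_def indicator_def)
        ultimately show ?thesis by (simp add: set_integrable_def)
      qed
      show "expectation (S 1) > 0" by (rule mean_waiting_time_pos[OF assms(3)])
      have "(\<Sum>i=1..n. cycle_integral S B (\<lambda>_. 1) i \<omega>) = reset_time S n \<omega>" for n
        unfolding reset_time_def using elim by (intro sum.cong refl cycle_integral_one) auto
      then show "(\<lambda>n. reset_time S n \<omega> / real n) \<longlonglongrightarrow> expectation (S 1)"
        using elim(3) unfolding mean_one by simp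
    qed (use elim in auto)
    then show ?case by (rule reset_path.additive_functional_mean_tendsto)
  qed
qed

end
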